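(* Let $G$ be a countable amenable group. (Borel version) Let $X$ be a standard Borel space and let $G\curvearrowright X$ be a free Borel action. Assume that $\mathrm{asdim}_{\mathbf{B}}(H\curvearrowright X)<\infty$ for every finitely generated subgroup $H\le G$. Then for every nonempty finite $K\subseteq G$ and $\delta>0$ there exist $(K,\delta)$-invariant finite sets $F_1,\dots,F_n\subseteq G$ and Borel sets $C_1,\dots,C_n\subseteq X$ such that the map $\theta:\bigsqcup_{i=1}^n F_i\times C_i\to X$ given by $\theta(f,c)=f\cdot c$ is a bijection. (Topological version) Let $X$ be a compact $0$-dimensional second countable Hausdorff space and let $G$ act continuously and freely on $X$. Assume that the dynamic asymptotic dimension of $H\curvearrowright X$ is finite for every finitely generated subgroup $H\le G$. Then for every nonempty finite $K\subseteq G$ and $\delta>0$ there exist $(K,\delta)$-invariant finite sets $F_1,\dots,F_n\subseteq G$ and clopen sets $C_1,\dots,C_n\subseteq X$ such that the map $\theta:\bigsqcup_{i=1}^n F_i\times C_i\to X$ given by $\theta(f,c)=f\cdot c$ is a bijection.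
   Context: For a nonempty finite set $K\subseteq G$ and $\delta>0$, a finite set $F\subseteq G$ is $(K,\delta)$-invariant if $|(KF)\triangle F|<\delta|F|$. An action is free if $g\cdot x\neq x$ for all $x$ and all $g\ne 1_G$. A space is $0$-dimensional if it has a base of clopen sets. Borel asymptotic dimension of an action: let $H$ be a countable group with a Borel action on a standard Borel space $X$, and let $\tau$ be a proper (balls of finite radius are finite) right-invariant metric on $H$. Let $\rho_\tau(x,y)=\min\{\tau(1_H,h): h\in H,\ h\cdot x=y\}$ if this set is nonempty and $+\infty$ otherwise. Then $\mathrm{asdim}_{\mathbf{B}}(H\curvearrowright X)$ is the least $d\in\mathbb{N}$ such that for every $r>0$ there is a Borel equivalence relation $E$ on $X$, with a finite uniform bound on the $\rho_\tau$-diameters of its classes, such that every closed $\rho_\tau$-ball of radius $r$ meets at most $d+1$ classes of $E$; it is $\infty$ if no such $d$ exists. It does not depend on the choice of $\tau$. Dynamic asymptotic dimension: for a discrete group $H$ acting continuously on a locally compact Hausdorff space $X$, it is the least $d\in\mathbb{N}$ such that for every compact $L\subseteq X$ and finite $B\subseteq H$ there are open sets $U_0,\dots,U_d$ covering $L$ such that for every $i$ the set $T_B^{U_i}$ is finite, where $h\in T_B^{U}$ iff there are $x\in U$, $m\ge1$ and $b_1,\dots,b_m\in B\cup B^{-1}$ with $h=b_m\cdots b_1$ and $b_k\cdots b_1\cdot x\in U$ for all $1\le k\le m$; it is $\infty$ if no such $d$ exists. *)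

theory Defs
  imports "HOL-Analysis.Analysis" "HOL-Algebra.Group_Action" "HOL-Algebra.Generated_Groups"
begin

definition fin_gen_subgroup :: "'g set \<Rightarrow> ('g, 'm) monoid_scheme \<Rightarrow> bool" where
  "fin_gen_subgroup H G \<longleftrightarrow>
     subgroup H G \<and> (\<exists>S. finite S \<and> S \<subseteq> carrier G \<and> H = generate G S)"

text \<open>The strict inequality forces an invariant set to be nonempty.\<close>

definition invariant_set ::
  "('g, 'm) monoid_scheme \<Rightarrow> 'g set \<Rightarrow> real \<Rightarrow> 'g set \<Rightarrow> bool" where
  "invariant_set G K \<delta> F \<longleftrightarrow>
     finite F \<and> F \<subseteq> carrier G \<and>
     real (card (sym_diff (K <#>\<^bsub>G\<^esub> F) F)) < \<delta> * real (card F)"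

text \<open>Amenability of a discrete group, in Folner's form.\<close>

definition amenable_group :: "('g, 'm) monoid_scheme \<Rightarrow> bool" where
  "amenable_group G \<longleftrightarrow>
     group G \<and>
     (\<forall>K \<delta>. finite K \<and> K \<noteq> {} \<and> K \<subseteq> carrier G \<and> \<delta> > 0 \<longrightarrow>
        (\<exists>F. invariant_set G K \<delta> F))"

text \<open>
  Groups are discrete, so Borel and continuous actions are those for which the action map is
  Borel, respectively continuous, with respect to the discrete structure on the group. An action
  of a group is also used as an action of each of its subgroups, without renaming it.
\<close>

definition borel_action ::
  "('g, 'm) monoid_scheme \<Rightarrow> 'x measure \<Rightarrow> ('g \<Rightarrow> 'x \<Rightarrow> 'x) \<Rightarrow> bool" where
  "borel_action G M \<phi> \<longleftrightarrow>
     group_action G (space M) \<phi> \<and>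
     (\<lambda>(g, x). \<phi> g x) \<in> count_space (carrier G) \<Otimes>\<^sub>M M \<rightarrow>\<^sub>M M"

definition continuous_action ::
  "('g, 'm) monoid_scheme \<Rightarrow> 'x topology \<Rightarrow> ('g \<Rightarrow> 'x \<Rightarrow> 'x) \<Rightarrow> bool" where
  "continuous_action G T \<phi> \<longleftrightarrow>
     group_action G (topspace T) \<phi> \<and>
     continuous_map (prod_topology (discrete_topology (carrier G)) T) T (\<lambda>(g, x). \<phi> g x)"

definition free_action ::
  "('g, 'm) monoid_scheme \<Rightarrow> 'x set \<Rightarrow> ('g \<Rightarrow> 'x \<Rightarrow> 'x) \<Rightarrow> bool" where
  "free_action G X \<phi> \<longleftrightarrow> (\<forall>g\<in>carrier G. \<forall>x\<in>X. g \<noteq> \<one>\<^bsub>G\<^esub> \<longrightarrow> \<phi> g x \<noteq> x)"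

text \<open>Of \<open>M\<close> only the underlying measurable space matters; its measure is ignored throughout.\<close>

definition standard_borel_space :: "'x measure \<Rightarrow> bool" where
  "standard_borel_space M \<longleftrightarrow>
     (\<exists>T. completely_metrizable_space T \<and> separable_space T \<and>
          topspace T = space M \<and> sets M = sigma_sets (topspace T) {U. openin T U})"

definition zero_dimensional_space :: "'x topology \<Rightarrow> bool" where
  "zero_dimensional_space T \<longleftrightarrow>
     (\<exists>\<B>. (\<forall>V\<in>\<B>. openin T V \<and> closedin T V) \<and>
          (\<forall>U x. openin T U \<and> x \<in> U \<longrightarrow> (\<exists>V\<in>\<B>. x \<in> V \<and> V \<subseteq> U)))"


definition proper_right_invariant_metric ::
  "('g, 'm) monoid_scheme \<Rightarrow> ('g \<Rightarrow> 'g \<Rightarrow> real) \<Rightarrow> bool" where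
  "proper_right_invariant_metric H \<tau> \<longleftrightarrow>
     Metric_space (carrier H) \<tau> \<and>
     (\<forall>a\<in>carrier H. \<forall>r. finite (Metric_space.mcball (carrier H) \<tau> a r)) \<and>
     (\<forall>a\<in>carrier H. \<forall>b\<in>carrier H. \<forall>c\<in>carrier H.
        \<tau> (a \<otimes>\<^bsub>H\<^esub> c) (b \<otimes>\<^bsub>H\<^esub> c) = \<tau> a b)"

text \<open>
  For proper \<open>\<tau>\<close> the infimum over a nonempty set is attained; over the empty set it is \<open>\<infinity>\<close>.
\<close>

definition action_dist ::
  "('g, 'm) monoid_scheme \<Rightarrow> ('g \<Rightarrow> 'x \<Rightarrow> 'x) \<Rightarrow> ('g \<Rightarrow> 'g \<Rightarrow> real) \<Rightarrow> 'x \<Rightarrow> 'x \<Rightarrow> ereal" where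
  "action_dist H \<phi> \<tau> x y = (INF h\<in>{h \<in> carrier H. \<phi> h x = y}. ereal (\<tau> \<one>\<^bsub>H\<^esub> h))"

definition borel_asdim_le ::
  "('g, 'm) monoid_scheme \<Rightarrow> 'x measure \<Rightarrow> ('g \<Rightarrow> 'x \<Rightarrow> 'x) \<Rightarrow> ('g \<Rightarrow> 'g \<Rightarrow> real) \<Rightarrow> nat \<Rightarrow> bool" where
  "borel_asdim_le H M \<phi> \<tau> d \<longleftrightarrow>
     (\<forall>r::real. r > 0 \<longrightarrow>
        (\<exists>E. equiv (space M) E \<and> E \<in> sets (M \<Otimes>\<^sub>M M) \<and>
             (\<exists>R::real. \<forall>(x, y)\<in>E. action_dist H \<phi> \<tau> x y \<le> ereal R) \<and>
             (\<forall>x\<in>space M.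
                let \<C> = {C \<in> space M // E.
                           C \<inter> {y \<in> space M. action_dist H \<phi> \<tau> x y \<le> ereal r} \<noteq> {}}
                in finite \<C> \<and> card \<C> \<le> d + 1)))"

definition borel_asdim_wrt ::
  "('g, 'm) monoid_scheme \<Rightarrow> 'x measure \<Rightarrow> ('g \<Rightarrow> 'x \<Rightarrow> 'x) \<Rightarrow> ('g \<Rightarrow> 'g \<Rightarrow> real) \<Rightarrow> enat" where
  "borel_asdim_wrt H M \<phi> \<tau> = (INF d\<in>{d. borel_asdim_le H M \<phi> \<tau> d}. enat d)"

text \<open>
  Every countable group carries a proper right-invariant metric, and the dimension is the same
  for all of them; the infimum below is this common value.
\<close>

definition borel_asdim ::
  "('g, 'm) monoid_scheme \<Rightarrow> 'x measure \<Rightarrow> ('g \<Rightarrow> 'x \<Rightarrow> 'x) \<Rightarrow> enat" where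
  "borel_asdim H M \<phi> =
     (INF \<tau>\<in>{\<tau>. proper_right_invariant_metric H \<tau>}. borel_asdim_wrt H M \<phi> \<tau>)"


text \<open>\<open>word_prod H b m\<close> is the product \<open>b m \<otimes> \<dots> \<otimes> b 1\<close>; the value \<open>b 0\<close> is not used.\<close>

primrec word_prod :: "('g, 'm) monoid_scheme \<Rightarrow> (nat \<Rightarrow> 'g) \<Rightarrow> nat \<Rightarrow> 'g" where
  "word_prod H b 0 = \<one>\<^bsub>H\<^esub>"
| "word_prod H b (Suc k) = b (Suc k) \<otimes>\<^bsub>H\<^esub> word_prod H b k"

definition return_set ::
  "('g, 'm) monoid_scheme \<Rightarrow> ('g \<Rightarrow> 'x \<Rightarrow> 'x) \<Rightarrow> 'g set \<Rightarrow> 'x set \<Rightarrow> 'g set" where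
  "return_set H \<phi> B U =
     {h. \<exists>x\<in>U. \<exists>m\<ge>1. \<exists>b. (\<forall>k\<in>{1..m}. b k \<in> B \<union> set_inv\<^bsub>H\<^esub> B) \<and>
           h = word_prod H b m \<and> (\<forall>k\<in>{1..m}. \<phi> (word_prod H b k) x \<in> U)}"

definition dyn_asdim_le ::
  "('g, 'm) monoid_scheme \<Rightarrow> 'x topology \<Rightarrow> ('g \<Rightarrow> 'x \<Rightarrow> 'x) \<Rightarrow> nat \<Rightarrow> bool" where
  "dyn_asdim_le H T \<phi> d \<longleftrightarrow>
     (\<forall>L B. compactin T L \<and> finite B \<and> B \<subseteq> carrier H \<longrightarrow>
        (\<exists>U. (\<forall>i\<le>d. openin T (U i)) \<and> L \<subseteq> (\<Union>i\<le>d. U i) \<and>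
             (\<forall>i\<le>d. finite (return_set H \<phi> B (U i)))))"

definition dyn_asdim ::
  "('g, 'm) monoid_scheme \<Rightarrow> 'x topology \<Rightarrow> ('g \<Rightarrow> 'x \<Rightarrow> 'x) \<Rightarrow> enat" where
  "dyn_asdim H T \<phi> = (INF d\<in>{d. dyn_asdim_le H T \<phi> d}. enat d)"

end

theory Submission
  imports Defs
begin

text \<open>
  Fix \<open>K\<close> and let \<open>H\<close> be the subgroup it generates; only the action of \<open>H\<close> matters. Finite dimension gives
  a partition into uniformly bounded pieces of bounded multiplicity at any prescribed scale. Thickening
  its pieces until their boundary is small, and resolving overlaps by a coloring, yields a partition
  whose cut points (points moved to another piece by \<open>K\<close>) are sparse. Call a piece bad if many of its
  points are cut points. By sparseness and amenability the bad pieces fill only a tiny fraction of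
  every translate of some Folner set \<open>W\<close>. A second partition, at a scale much larger than \<open>W\<close>, groups the
  good pieces; every bad point joins the group that receives most of its translates by \<open>W W\<^sup>-\<^sup>1\<close>. Few
  bad points join each group, so all groups are almost invariant, and they are the tiles.

  The same argument serves both settings, with the Borel sets or the clopen sets as the algebra of
  admissible sets.
\<close>

text \<open>Orbit growth is not controlled, so a thickened class cannot be given a boundary that is
  small relative to itself: among \<open>r\<close> successive shells one is small, but only relative
  to the largest thickening. Hence the cut points in a finite set \<open>V\<close> are sparse merely
  relative to \<open>act Q V\<close>, with \<open>Q\<close> depending on the partition, and single
  pieces may be bad. Amenability enters after that partition is fixed, through a set
  \<open>W\<close> adapted to \<open>Q\<close>. The bound
  \<open>card (Q <#> W) \<le> 2 * card W\<close> is enough, because the smallness itself was bought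
  by the scale of the first partition. The second partition limits the number of coarse classes that
  can compete for a bad point to \<open>d + 1\<close>. Some class therefore receives a share of at
  least \<open>1 / (2 * (d + 1))\<close> of the moves. This share is known in advance, so the
  required sparseness of bad points can be fixed before the first partition is made. Freeness
  identifies points of an orbit with group elements, which reduces each local pattern to finitely
  many measurable cases.\<close>

text \<open>
  \<open>A\<close> is the algebra of Borel or of clopen sets. Countable unions occur only in the construction of
  colorings, which is therefore an axiom here.
\<close>

locale measured_action = group_action G X \<phi>
  for G (structure) and X :: "'x set" and \<phi> :: "'g \<Rightarrow> 'x \<Rightarrow> 'x" +
  fixes A :: "'x set set"
  assumes free: "\<lbrakk>g \<in> carrier G; x \<in> X; \<phi> g x = x\<rbrakk> \<Longrightarrow> g = \<one>"
    and algebra_A: "algebra X A"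
    and translate_A: "\<lbrakk>g \<in> carrier G; U \<in> A\<rbrakk> \<Longrightarrow> {x \<in> X. \<phi> g x \<in> U} \<in> A"
    and coloring: "\<lbrakk>finite S; S \<subseteq> carrier G - {\<one>}\<rbrakk> \<Longrightarrow>
      \<exists>\<kappa> :: 'x \<Rightarrow> nat. (\<forall>x\<in>X. \<forall>s\<in>S. \<kappa> (\<phi> s x) \<noteq> \<kappa> x) \<and>
        (\<forall>g\<in>carrier G. \<forall>h\<in>carrier G. {x \<in> X. \<kappa> (\<phi> g x) \<le> \<kappa> (\<phi> h x)} \<in> A)"
begin

sublocale group G
  using group_hom group_hom.axioms(1) by auto

section \<open>Free actions\<close>

lemma act_closed [simp, intro]: "\<lbrakk>g \<in> carrier G; x \<in> X\<rbrakk> \<Longrightarrow> \<phi> g x \<in> X"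
  using element_image by blast

lemma act_one [simp]: "x \<in> X \<Longrightarrow> \<phi> \<one> x = x"
  by (metis id_eq_one restrict_apply')

lemma act_mult: "\<lbrakk>g \<in> carrier G; h \<in> carrier G; x \<in> X\<rbrakk> \<Longrightarrow> \<phi> (g \<otimes> h) x = \<phi> g (\<phi> h x)"
  by (rule composition_rule)

lemma act_inv [simp]: "\<lbrakk>g \<in> carrier G; x \<in> X\<rbrakk> \<Longrightarrow> \<phi> (inv g) (\<phi> g x) = x"
  using orbit_sym_aux by blast

lemma act_inv' [simp]: "\<lbrakk>g \<in> carrier G; x \<in> X\<rbrakk> \<Longrightarrow> \<phi> g (\<phi> (inv g) x) = x"
  using act_inv[of "inv g" x] by simp

lemma act_inj: "\<lbrakk>g \<in> carrier G; h \<in> carrier G; x \<in> X\<rbrakk> \<Longrightarrow> \<phi> g x = \<phi> h x \<longleftrightarrow> g = h"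
proof
  assume a: "g \<in> carrier G" "h \<in> carrier G" "x \<in> X" "\<phi> g x = \<phi> h x"
  then have "\<phi> (inv h \<otimes> g) x = x" by (simp add: act_mult)
  then have "inv h \<otimes> g = \<one>" using a free by simp
  then show "g = h" using a by (metis inv_closed inv_equality inv_inv)
qed auto

section \<open>Measurable predicates and simple functions\<close>

text \<open>Measurability is attached to predicates, so that its proof follows the logical form of
  the predicate. Quantifiers must range over finite sets, as \<open>A\<close> is only an
  algebra.\<close>

definition meas :: "('x \<Rightarrow> bool) \<Rightarrow> bool" where
  "meas P \<longleftrightarrow> {x \<in> X. P x} \<in> A"

lemma meas_cong: "\<lbrakk>meas P; \<And>x. x \<in> X \<Longrightarrow> P x \<longleftrightarrow> Q x\<rbrakk> \<Longrightarrow> meas Q"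
  unfolding meas_def by (metis (no_types, lifting) Collect_cong)

lemma meas_const [simp]: "meas (\<lambda>x. c)"
proof -
  interpret algebra X A by (rule algebra_A)
  show ?thesis by (cases c) (auto simp: meas_def)
qed

lemma meas_not: "meas P \<Longrightarrow> meas (\<lambda>x. \<not> P x)"
proof -
  interpret algebra X A by (rule algebra_A)
  assume "meas P"
  then have "X - {x \<in> X. P x} \<in> A" by (auto simp: meas_def)
  moreover have "X - {x \<in> X. P x} = {x \<in> X. \<not> P x}" by auto
  ultimately show ?thesis by (simp add: meas_def)
qed

lemma meas_conj: "\<lbrakk>meas P; meas Q\<rbrakk> \<Longrightarrow> meas (\<lambda>x. P x \<and> Q x)"
proof -
  interpret algebra X A by (rule algebra_A)
  assume "meas P" "meas Q"
  then have "{x \<in> X. P x} \<inter> {x \<in> X. Q x} \<in> A" by (auto simp: meas_def)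
  moreover have "{x \<in> X. P x} \<inter> {x \<in> X. Q x} = {x \<in> X. P x \<and> Q x}" by auto
  ultimately show ?thesis by (simp add: meas_def)
qed

lemma meas_disj:
  assumes "meas P" "meas Q" shows "meas (\<lambda>x. P x \<or> Q x)"
  by (rule meas_cong[OF meas_not[OF meas_conj[OF meas_not[OF assms(1)] meas_not[OF assms(2)]]]]) simp

lemma meas_imp:
  assumes "meas P" "meas Q" shows "meas (\<lambda>x. P x \<longrightarrow> Q x)"
  by (rule meas_cong[OF meas_disj[OF meas_not[OF assms(1)] assms(2)]]) simp

lemma meas_bex: "\<lbrakk>finite J; \<And>j. j \<in> J \<Longrightarrow> meas (P j)\<rbrakk> \<Longrightarrow> meas (\<lambda>x. \<exists>j\<in>J. P j x)"
  by (induction J rule: finite_induct) (simp_all add: meas_disj)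

lemma meas_ball: "\<lbrakk>finite J; \<And>j. j \<in> J \<Longrightarrow> meas (P j)\<rbrakk> \<Longrightarrow> meas (\<lambda>x. \<forall>j\<in>J. P j x)"
  by (induction J rule: finite_induct) (simp_all add: meas_conj)

lemma meas_translate:
  assumes "g \<in> carrier G" "meas P" shows "meas (\<lambda>x. P (\<phi> g x))"
proof -
  have "{x \<in> X. \<phi> g x \<in> {x \<in> X. P x}} = {x \<in> X. P (\<phi> g x)}" using assms(1) by auto
  then show ?thesis using translate_A[OF assms(1)] assms(2) unfolding meas_def by fastforce
qed

text \<open>Simple functions in the sense of measure theory, with values in any type. Choices of
  shifts and radii will be functions of such data.\<close>

definition simple :: "('x \<Rightarrow> 'b) \<Rightarrow> bool" where
  "simple s \<longleftrightarrow> finite (s ` X) \<and> (\<forall>v. meas (\<lambda>x. s x = v))"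

lemma simpleI:
  assumes "finite V" "\<And>x. x \<in> X \<Longrightarrow> s x \<in> V" "\<And>v. v \<in> V \<Longrightarrow> meas (\<lambda>x. s x = v)"
  shows "simple s"
proof -
  have "meas (\<lambda>x. s x = v)" for v
  proof (cases "v \<in> V")
    case False
    then show ?thesis using assms(2) by (intro meas_cong[OF meas_const[of False]]) auto
  qed (use assms in auto)
  then show ?thesis
    using assms by (auto simp: simple_def intro: finite_subset[of _ V])
qed

text \<open>Splitting over the finitely many values of \<open>s\<close> gives a finite disjunction
  in which the value is a constant.\<close>

lemma meas_simple:
  assumes "simple s" "\<And>v. v \<in> s ` X \<Longrightarrow> meas (Q v)"
  shows "meas (\<lambda>x. Q (s x) x)"
proof (rule meas_cong)
  show "meas (\<lambda>x. \<exists>v\<in>s ` X. s x = v \<and> Q v x)"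
    using assms by (intro meas_bex meas_conj) (auto simp: simple_def)
qed auto

lemma simple_subst:
  assumes "simple s" "\<And>v. v \<in> s ` X \<Longrightarrow> simple (t v)"
  shows "simple (\<lambda>x. t (s x) x)"
proof (rule simpleI)
  show "finite (\<Union>v\<in>s ` X. t v ` X)"
    using assms unfolding simple_def by (intro finite_UN_I) simp_all
  show "meas (\<lambda>x. t (s x) x = v)" for v
    using assms by (intro meas_simple[of s "\<lambda>a x. t a x = v"]) (auto simp: simple_def)
qed auto

lemma simple_const [simp]: "simple (\<lambda>x. c)"
  by (rule simpleI[of "{c}"]) auto

lemma simple_comp: "simple s \<Longrightarrow> simple (\<lambda>x. f (s x))"
  by (rule simple_subst[of s "\<lambda>v x. f v"]) auto

lemma simple_comp2: "\<lbrakk>simple s; simple t\<rbrakk> \<Longrightarrow> simple (\<lambda>x. f (s x) (t x))"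
  by (rule simple_subst[of s "\<lambda>v x. f v (t x)"]) (auto intro: simple_comp)

lemma meas_comp: "simple s \<Longrightarrow> meas (\<lambda>x. Q (s x))"
  by (rule meas_simple[of s "\<lambda>v x. Q v"]) auto

lemma simple_Collect:
  assumes "finite J" "\<And>j. j \<in> J \<Longrightarrow> meas (P j)"
  shows "simple (\<lambda>x. {j\<in>J. P j x})"
proof (rule simpleI[of "Pow J"])
  fix v assume v: "v \<in> Pow J"
  have "meas (\<lambda>x. \<forall>j\<in>J. (j \<in> v \<longrightarrow> P j x) \<and> (P j x \<longrightarrow> j \<in> v))"
    using assms by (intro meas_ball meas_conj meas_imp) auto
  then show "meas (\<lambda>x. {j\<in>J. P j x} = v)"
    by (rule meas_cong) (use v in blast)
qed (use assms in auto)

section \<open>Maps of bounded displacement\<close>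

text \<open>
  A partition into pieces of uniformly bounded diameter is encoded by a map that moves every point by
  one of finitely many group elements, chosen measurably; the pieces are its fibers. The value of such
  a map need not lie in the piece.
\<close>

definition address :: "('x \<Rightarrow> 'x) \<Rightarrow> bool" where
  "address f \<longleftrightarrow> (\<exists>s. simple s \<and> s ` X \<subseteq> carrier G \<and> (\<forall>x\<in>X. f x = \<phi> (s x) x))"

lemma address_act [simp]: "g \<in> carrier G \<Longrightarrow> address (\<phi> g)"
  unfolding address_def by (rule exI[of _ "\<lambda>x. g"]) auto

lemma address_closed: "\<lbrakk>address f; x \<in> X\<rbrakk> \<Longrightarrow> f x \<in> X"
  by (auto simp: address_def)

lemma address_bounded:
  assumes "address f"
  obtains B where "finite B" "B \<subseteq> carrier G" "\<And>x. x \<in> X \<Longrightarrow> \<exists>b\<in>B. x = \<phi> b (f x)"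
    "\<And>x. x \<in> X \<Longrightarrow> \<exists>b\<in>B. f x = \<phi> b x"
proof -
  obtain s where s: "simple s" "s ` X \<subseteq> carrier G" "\<forall>x\<in>X. f x = \<phi> (s x) x"
    using assms by (auto simp: address_def)
  let ?B = "(\<lambda>g. inv g) ` s ` X \<union> s ` X"
  have cl: "s x \<in> carrier G" if "x \<in> X" for x using s(2) that by auto
  show ?thesis
  proof (rule that[of ?B])
    show "finite ?B" using s(1) by (simp add: simple_def)
    show "?B \<subseteq> carrier G" using cl by auto
    fix x assume x: "x \<in> X"
    show "\<exists>b\<in>?B. x = \<phi> b (f x)"
      using x s(3) cl by (intro bexI[of _ "inv (s x)"]) auto
    show "\<exists>b\<in>?B. f x = \<phi> b x"
      using x s(3) cl by (intro bexI[of _ "s x"]) auto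
  qed
qed

lemma meas_address: "\<lbrakk>address f; meas P\<rbrakk> \<Longrightarrow> meas (\<lambda>x. P (f x))"
proof -
  assume a: "address f" "meas P"
  obtain s where s: "simple s" "s ` X \<subseteq> carrier G" "\<forall>x\<in>X. f x = \<phi> (s x) x"
    using a(1) by (auto simp: address_def)
  have "meas (\<lambda>x. P (\<phi> (s x) x))"
    using s a(2) by (intro meas_simple[of s "\<lambda>g x. P (\<phi> g x)"] meas_translate) auto
  then show ?thesis by (rule meas_cong) (use s in simp)
qed

lemma simple_address: "\<lbrakk>simple s; address f\<rbrakk> \<Longrightarrow> simple (\<lambda>x. s (f x))"
  by (rule simpleI[of "s ` X"]) (auto simp: simple_def intro: address_closed meas_address)

lemma address_comp: "\<lbrakk>address f; address g\<rbrakk> \<Longrightarrow> address (\<lambda>x. f (g x))"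
proof -
  assume a: "address f" "address g"
  obtain s where s: "simple s" "s ` X \<subseteq> carrier G" "\<forall>x\<in>X. f x = \<phi> (s x) x"
    using a(1) by (auto simp: address_def)
  obtain t where t: "simple t" "t ` X \<subseteq> carrier G" "\<forall>x\<in>X. g x = \<phi> (t x) x"
    using a(2) by (auto simp: address_def)
  have cl: "s x \<in> carrier G" "t x \<in> carrier G" if "x \<in> X" for x using s(2) t(2) that by auto
  show ?thesis unfolding address_def
  proof (intro exI[of _ "\<lambda>x. s (g x) \<otimes> t x"] conjI ballI)
    show "simple (\<lambda>x. s (g x) \<otimes> t x)"
      using simple_comp2[of "\<lambda>x. s (g x)" t] simple_address[OF s(1) a(2)] t(1) by blast
    show "(\<lambda>x. s (g x) \<otimes> t x) ` X \<subseteq> carrier G"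
      using cl address_closed[OF a(2)] by auto
    fix x assume x: "x \<in> X"
    then have gx: "g x \<in> X" using address_closed[OF a(2)] by simp
    show "f (g x) = \<phi> (s (g x) \<otimes> t x) x"
      using s(3) gx t(3) x cl by (simp add: act_mult)
  qed
qed

lemma meas_address_rel:
  assumes "address f" "address g"
    and "\<And>a b. \<lbrakk>a \<in> carrier G; b \<in> carrier G\<rbrakk> \<Longrightarrow> meas (\<lambda>x. R (\<phi> a x) (\<phi> b x))"
  shows "meas (\<lambda>x. R (f x) (g x))"
proof -
  obtain s where s: "simple s" "s ` X \<subseteq> carrier G" "\<forall>x\<in>X. f x = \<phi> (s x) x"
    using assms(1) by (auto simp: address_def)
  obtain t where t: "simple t" "t ` X \<subseteq> carrier G" "\<forall>x\<in>X. g x = \<phi> (t x) x"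
    using assms(2) by (auto simp: address_def)
  have "meas (\<lambda>x. R (\<phi> a x) (\<phi> (t x) x))" if "a \<in> carrier G" for a
    using t that assms(3) by (intro meas_simple[of t "\<lambda>b x. R (\<phi> a x) (\<phi> b x)"]) auto
  then have "meas (\<lambda>x. R (\<phi> (s x) x) (\<phi> (t x) x))"
    using s by (intro meas_simple[of s "\<lambda>a x. R (\<phi> a x) (\<phi> (t x) x)"]) auto
  then show ?thesis by (rule meas_cong) (use s t in simp)
qed

text \<open>By freeness \<open>\<phi> a x = \<phi> b x\<close> holds at every point or at none, so
  the equality of two addresses depends only on their displacements.\<close>

lemma meas_address_eq:
  assumes "address f" "address g" shows "meas (\<lambda>x. f x = g x)"
  using assms
proof (rule meas_address_rel)
  fix a b assume "a \<in> carrier G" "b \<in> carrier G"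
  then show "meas (\<lambda>x. \<phi> a x = \<phi> b x)"
    by (intro meas_cong[OF meas_const[of "a = b"]]) (simp add: act_inj)
qed

text \<open>The index is chosen as a function of the finite set of admissible indices. That set is a
  simple function of \<open>x\<close>, so the choice is one as well.\<close>

lemma address_select:
  assumes "finite J" "\<And>j. j \<in> J \<Longrightarrow> address (f j)" "\<And>j. j \<in> J \<Longrightarrow> meas (P j)"
    and "\<And>x. x \<in> X \<Longrightarrow> \<exists>j\<in>J. P j x"
  obtains g where "address g" "\<And>x. x \<in> X \<Longrightarrow> \<exists>j\<in>J. P j x \<and> g x = f j x"
proof -
  define k where "k x = (SOME j. j \<in> {j \<in> J. P j x})" for x
  have k: "k x \<in> {j \<in> J. P j x}" if "x \<in> X" for x
    unfolding k_def some_in_eq using assms(4)[OF that] by auto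
  have kJ: "k x \<in> J" "P (k x) x" if "x \<in> X" for x using k[OF that] by auto
  have sk: "simple k"
    unfolding k_def by (rule simple_comp[of _ "\<lambda>N. SOME j. j \<in> N"]) (rule simple_Collect[OF assms(1,3)])
  have "\<forall>j\<in>J. \<exists>s. simple s \<and> s ` X \<subseteq> carrier G \<and> (\<forall>x\<in>X. f j x = \<phi> (s x) x)"
    using assms(2) by (simp add: address_def)
  then obtain s where s: "\<forall>j\<in>J. simple (s j) \<and> s j ` X \<subseteq> carrier G \<and> (\<forall>x\<in>X. f j x = \<phi> (s j x) x)"
    by (rule bchoice[THEN exE])
  have ks: "simple (\<lambda>x. s (k x) x)"
  proof (rule simple_subst[OF sk])
    fix v assume "v \<in> k ` X"
    then have "v \<in> J" using kJ by auto
    then show "simple (s v)" using s by simp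
  qed
  have cl: "s (k x) x \<in> carrier G" if "x \<in> X" for x
    using s[rule_format, OF kJ(1)[OF that]] that by auto
  have eq: "f (k x) x = \<phi> (s (k x) x) x" if "x \<in> X" for x
    using s[rule_format, OF kJ(1)[OF that]] that by simp
  show ?thesis
  proof (rule that[of "\<lambda>x. f (k x) x"])
    show "address (\<lambda>x. f (k x) x)" unfolding address_def
      by (rule exI[of _ "\<lambda>x. s (k x) x"]) (use ks cl eq in auto)
    show "\<exists>j\<in>J. P j x \<and> f (k x) x = f j x" if "x \<in> X" for x
      by (rule bexI[of _ "k x"]) (use kJ[OF that] in auto)
  qed
qed

section \<open>Translates and fibers\<close>

definition act :: "'g set \<Rightarrow> 'x set \<Rightarrow> 'x set" where
  "act B S = (\<Union>b\<in>B. \<phi> b ` S)"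

lemma actI: "\<lbrakk>b \<in> B; x \<in> S\<rbrakk> \<Longrightarrow> \<phi> b x \<in> act B S"
  by (auto simp: act_def)

lemma act_subset: "\<lbrakk>B \<subseteq> carrier G; S \<subseteq> X\<rbrakk> \<Longrightarrow> act B S \<subseteq> X"
  by (auto simp: act_def)

lemma finite_act: "\<lbrakk>finite B; finite S\<rbrakk> \<Longrightarrow> finite (act B S)"
  by (auto simp: act_def)

lemma card_act_le: "\<lbrakk>finite B; finite S\<rbrakk> \<Longrightarrow> card (act B S) \<le> card B * card S"
proof -
  assume fin: "finite B" "finite S"
  then have "card (act B S) \<le> (\<Sum>b\<in>B. card (\<phi> b ` S))"
    unfolding act_def by (intro card_UN_le)
  also have "\<dots> \<le> (\<Sum>b\<in>B. card S)" by (rule sum_mono) (rule card_image_le[OF fin(2)])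
  finally show ?thesis by simp
qed

lemma act_mono: "\<lbrakk>B \<subseteq> B'; S \<subseteq> S'\<rbrakk> \<Longrightarrow> act B S \<subseteq> act B' S'"
  unfolding act_def by blast

lemma act_act: "\<lbrakk>B \<subseteq> carrier G; C \<subseteq> carrier G; S \<subseteq> X\<rbrakk> \<Longrightarrow> act B (act C S) = act (B <#> C) S"
proof -
  assume a: "B \<subseteq> carrier G" "C \<subseteq> carrier G" "S \<subseteq> X"
  have *: "\<phi> b (\<phi> c x) = \<phi> (b \<otimes> c) x" if "b \<in> B" "c \<in> C" "x \<in> S" for b c x
    by (rule act_mult[symmetric]) (use that a in auto)
  show ?thesis
  proof (intro equalityI subsetI)
    fix y assume "y \<in> act B (act C S)"
    then obtain b c x where "b \<in> B" "c \<in> C" "x \<in> S" "y = \<phi> b (\<phi> c x)" by (auto simp: act_def)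
    then show "y \<in> act (B <#> C) S" using * by (auto simp: act_def set_mult_def)
  next
    fix y assume "y \<in> act (B <#> C) S"
    then obtain b c x where "b \<in> B" "c \<in> C" "x \<in> S" "y = \<phi> (b \<otimes> c) x" by (auto simp: act_def set_mult_def)
    then show "y \<in> act B (act C S)" by (simp add: actI flip: *)
  qed
qed

lemma card_act_point: "\<lbrakk>B \<subseteq> carrier G; x \<in> X\<rbrakk> \<Longrightarrow> card (act B {x}) = card B"
proof -
  assume a: "B \<subseteq> carrier G" "x \<in> X"
  have "act B {x} = (\<lambda>b. \<phi> b x) ` B" by (auto simp: act_def)
  moreover have "inj_on (\<lambda>b. \<phi> b x) B"
    using a by (intro inj_onI) (auto simp: act_inj subset_iff)
  ultimately show ?thesis by (simp add: card_image)
qed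

definition fiber :: "('x \<Rightarrow> 'x) \<Rightarrow> 'x \<Rightarrow> 'x set" where
  "fiber f p = {x \<in> X. f x = p}"

lemma mem_fiber: "x \<in> fiber f p \<longleftrightarrow> x \<in> X \<and> f x = p"
  by (simp add: fiber_def)

lemma fiber_bounded:
  assumes "address f"
  obtains B where "finite B" "B \<subseteq> carrier G" "\<And>p. fiber f p \<subseteq> act B {p}"
  by (rule address_bounded[OF assms]) (rule that, auto simp: fiber_def act_def)

lemma finite_fiber [simp]: "address f \<Longrightarrow> finite (fiber f p)"
  by (rule fiber_bounded[of f]) (auto intro: finite_subset[OF _ finite_act])

end

section \<open>Counting\<close>

lemma double_counting:
  assumes "finite P" "finite Y" "\<And>p. p \<in> P \<Longrightarrow> L p \<subseteq> Y"
    and "\<And>y. y \<in> Y \<Longrightarrow> card {p \<in> P. y \<in> L p} \<le> c"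
  shows "(\<Sum>p\<in>P. card (L p)) \<le> c * card Y"
proof -
  have "(\<Sum>p\<in>P. card (L p)) = (\<Sum>p\<in>P. \<Sum>y\<in>Y. if y \<in> L p then 1 else 0)"
  proof (rule sum.cong[OF refl])
    fix p assume "p \<in> P"
    then have "L p = {y \<in> Y. y \<in> L p}" using assms(3) by auto
    then show "card (L p) = (\<Sum>y\<in>Y. if y \<in> L p then 1 else 0)"
      using assms(2) by (simp add: sum.If_cases Int_def)
  qed
  also have "\<dots> = (\<Sum>y\<in>Y. \<Sum>p\<in>P. if y \<in> L p then 1 else 0)" by (rule sum.swap)
  also have "\<dots> = (\<Sum>y\<in>Y. card {p \<in> P. y \<in> L p})"
    using assms(1) by (simp add: sum.If_cases Int_def)
  also have "\<dots> \<le> (\<Sum>y\<in>Y. c)" using assms(4) by (rule sum_mono)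
  finally show ?thesis by (simp add: mult.commute)
qed

text \<open>The \<open>r\<close> increments telescope to at most \<open>c r\<close>, so one of them
  is at most the average. The comparison is with the final value, which makes it valid for any
  growth.\<close>

lemma ex_small_increment:
  fixes c :: "nat \<Rightarrow> nat"
  assumes "mono c" "0 < r"
  shows "\<exists>t<r. r * (c (Suc t) - c t) \<le> c r"
proof (rule ccontr)
  assume "\<not> ?thesis"
  then have *: "c r < r * (c (Suc t) - c t)" if "t < r" for t using that by (auto simp: not_le)
  have tel: "(\<Sum>t<n. c (Suc t) - c t) + c 0 = c n" for n
  proof (induction n)
    case (Suc n)
    have "c n \<le> c (Suc n)" using assms(1) by (simp add: monoD)
    then show ?case using Suc unfolding sum.lessThan_Suc by arith
  qed simp
  have "r * c r = (\<Sum>t<r. c r)" by simp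
  also have "\<dots> < (\<Sum>t<r. r * (c (Suc t) - c t))"
    using * assms(2) by (intro sum_strict_mono) auto
  also have "\<dots> \<le> r * c r"
    unfolding sum_distrib_left[symmetric] using tel[of r] by (intro mult_left_mono) auto
  finally show False by simp
qed

section \<open>Dimension, colorings, shapes and tilings\<close>

context measured_action
begin

text \<open>The common form of both dimensions: a finite set \<open>S\<close> of group elements
  replaces the radius, and the fibers of an address replace the classes.\<close>

definition asd_le :: "nat \<Rightarrow> bool" where
  "asd_le d \<longleftrightarrow> (\<forall>S. finite S \<and> S \<subseteq> carrier G \<longrightarrow>
     (\<exists>\<rho>. address \<rho> \<and> (\<forall>x\<in>X. card (\<rho> ` act S {x}) \<le> d + 1)))"

text \<open>Points \<open>\<phi> b x\<close> and \<open>\<phi> c x\<close> differ by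
  \<open>b \<otimes> inv c\<close>, so it is enough to separate points by these quotients. The
  colors may be infinite in number, hence only comparisons between them are recorded.\<close>

lemma coloring_inj:
  assumes "finite B" "B \<subseteq> carrier G"
  obtains \<kappa> :: "'x \<Rightarrow> nat" where "\<And>x. x \<in> X \<Longrightarrow> inj_on \<kappa> (act B {x})"
    "\<And>f g. \<lbrakk>address f; address g\<rbrakk> \<Longrightarrow> meas (\<lambda>x. \<kappa> (f x) \<le> \<kappa> (g x))"
proof -
  let ?S = "(\<lambda>(b, c). b \<otimes> inv c) ` (B \<times> B) - {\<one>}"
  have "finite ?S" "?S \<subseteq> carrier G - {\<one>}" using assms by auto
  from coloring[OF this] obtain \<kappa> :: "'x \<Rightarrow> nat" where
    \<kappa>: "\<forall>x\<in>X. \<forall>s\<in>?S. \<kappa> (\<phi> s x) \<noteq> \<kappa> x"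
      "\<forall>g\<in>carrier G. \<forall>h\<in>carrier G. {x \<in> X. \<kappa> (\<phi> g x) \<le> \<kappa> (\<phi> h x)} \<in> A" by auto
  show ?thesis
  proof (rule that[of \<kappa>])
    fix x assume x: "x \<in> X"
    show "inj_on \<kappa> (act B {x})"
    proof (rule inj_onI, rule ccontr)
      fix y z assume "y \<in> act B {x}" "z \<in> act B {x}" and e: "\<kappa> y = \<kappa> z" "y \<noteq> z"
      then obtain b c where bc: "b \<in> B" "c \<in> B" "y = \<phi> b x" "z = \<phi> c x" by (auto simp: act_def)
      have G: "b \<in> carrier G" "c \<in> carrier G" using bc assms(2) by auto
      have y: "y = \<phi> (b \<otimes> inv c) z" using bc G x by (simp add: act_mult)
      have "b \<otimes> inv c \<noteq> \<one>" using y e(2) x bc G by auto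
      then have "b \<otimes> inv c \<in> ?S" using bc by auto
      then have "\<kappa> y \<noteq> \<kappa> z" unfolding y using \<kappa>(1) bc G x by simp
      then show False using e by simp
    qed
  next
    fix f g assume "address f" "address g"
    then show "meas (\<lambda>x. \<kappa> (f x) \<le> \<kappa> (g x))"
      by (rule meas_address_rel[of f g "\<lambda>a b. \<kappa> a \<le> \<kappa> b"]) (use \<kappa>(2) in \<open>simp add: meas_def\<close>)
  qed
qed

text \<open>The fiber over \<open>p\<close>, read off in the group with base point \<open>p\<close>.
  A point need not lie in its own fiber: the shape may miss the identity, and for
  \<open>p \<in> X\<close> outside the range of an address \<open>f\<close> it is empty.\<close>

definition shape :: "('x \<Rightarrow> 'x) \<Rightarrow> 'x \<Rightarrow> 'g set" where
  "shape f p = {h \<in> carrier G. f (\<phi> h p) = p}"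

lemma fiber_eq_act_shape: "\<lbrakk>address f; p \<in> X\<rbrakk> \<Longrightarrow> fiber f p = act (shape f p) {p}"
proof -
  assume a: "address f" "p \<in> X"
  obtain B where B: "finite B" "B \<subseteq> carrier G" "\<And>x. x \<in> X \<Longrightarrow> \<exists>b\<in>B. x = \<phi> b (f x)"
    by (rule address_bounded[OF a(1)]) (rule that)
  show ?thesis
  proof (intro equalityI subsetI)
    fix x assume "x \<in> fiber f p"
    then have x: "x \<in> X" "f x = p" by (auto simp: mem_fiber)
    then obtain b where b: "b \<in> B" "x = \<phi> b p" using B(3) by auto
    then have "b \<in> shape f p" using B(2) x by (auto simp: shape_def)
    then show "x \<in> act (shape f p) {p}" using b by (auto intro: actI)
  qed (use a in \<open>auto simp: act_def shape_def mem_fiber\<close>)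
qed

lemma shape_carrier: "shape f p \<subseteq> carrier G"
  by (auto simp: shape_def)

lemma card_fiber: "\<lbrakk>address f; p \<in> X\<rbrakk> \<Longrightarrow> card (fiber f p) = card (shape f p)"
  by (simp add: fiber_eq_act_shape card_act_point shape_carrier)

text \<open>Points of the fiber over \<open>p\<close> are reached from \<open>p\<close> by a fixed
  finite set, and by freeness no other group element leads there. So all shapes are subsets of that
  set, cut out by measurable conditions.\<close>

lemma simple_shape: "address f \<Longrightarrow> simple (shape f)"
proof -
  assume a: "address f"
  obtain B where B: "finite B" "B \<subseteq> carrier G" "\<And>x. x \<in> X \<Longrightarrow> \<exists>b\<in>B. x = \<phi> b (f x)"
    by (rule address_bounded[OF a(1)]) (rule that)
  have "shape f p = {h \<in> B. f (\<phi> h p) = p}" if p: "p \<in> X" for p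
  proof -
    have "h \<in> B" if h: "h \<in> carrier G" "f (\<phi> h p) = p" for h
    proof -
      obtain b where b: "b \<in> B" "\<phi> h p = \<phi> b (f (\<phi> h p))" using B(3)[of "\<phi> h p"] h p by auto
      then have "b \<in> carrier G" using B(2) by auto
      then have "h = b" using h p b act_inj[of h b p] by simp
      then show ?thesis using b by simp
    qed
    then show ?thesis using B(2) by (auto simp: shape_def)
  qed
  moreover have "simple (\<lambda>p. {h \<in> B. f (\<phi> h p) = p})"
  proof (rule simple_Collect[OF B(1)])
    fix h assume "h \<in> B"
    then have "h \<in> carrier G" using B(2) by auto
    then have "address (\<lambda>p. f (\<phi> h p))" by (intro address_comp[OF a]) simp
    moreover have "address (\<lambda>p. p)"
      using address_act[OF one_closed] act_one unfolding address_def by auto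
    ultimately show "meas (\<lambda>p. f (\<phi> h p) = p)" by (rule meas_address_eq)
  qed
  ultimately show ?thesis
    unfolding simple_def by (auto intro: meas_cong cong: image_cong)
qed

lemma finite_shape: "\<lbrakk>address f; p \<in> X\<rbrakk> \<Longrightarrow> finite (shape f p)"
proof -
  assume a: "address f" "p \<in> X"
  have "inj_on (\<lambda>h. \<phi> h p) (shape f p)"
    using a shape_carrier[of f p] by (intro inj_onI) (auto simp: act_inj subset_iff)
  moreover have "(\<lambda>h. \<phi> h p) ` shape f p = fiber f p"
    using fiber_eq_act_shape[OF a] by (auto simp: act_def)
  ultimately show ?thesis using finite_fiber[OF a(1)] finite_imageD by metis
qed

text \<open>A partition into fibers is a tiling: the tiles are the finitely many nonempty shapes, and the
  center of the tile through \<open>x\<close> is \<open>\<Psi> x\<close>.\<close>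

lemma tiling_of_address:
  assumes \<Psi>: "address \<Psi>"
  obtains n :: nat and F C where
    "\<And>i. i \<in> {1..n} \<Longrightarrow> \<exists>p\<in>X. F i = shape \<Psi> p \<and> F i \<noteq> {}"
    "\<And>i. i \<in> {1..n} \<Longrightarrow> C i \<in> A"
    "bij_betw (\<lambda>(i, f, c). \<phi> f c) (SIGMA i:{1..n}. F i \<times> C i) X"
proof -
  \<comment> \<open>Centers outside the range of \<open>\<Psi>\<close> have the empty shape and are
    discarded.\<close>
  let ?\<F> = "shape \<Psi> ` X - {{}}"
  have fin: "finite ?\<F>" using simple_shape[OF \<Psi>] by (simp add: simple_def)
  define n where "n = card ?\<F>"
  obtain F where F: "bij_betw F {1..n} ?\<F>"
    using ex_bij_betw_nat_finite_1[OF fin] by (auto simp: n_def)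
  define C where "C i = {p \<in> X. shape \<Psi> p = F i}" for i
  have inj: "inj_on F {1..n}" and im: "F ` {1..n} = ?\<F>" using F by (auto simp: bij_betw_def)
  \<comment> \<open>A point of a tile determines all data: \<open>\<Psi>\<close> returns its center,
    the shape of the center gives the index, and freeness gives the group element.\<close>
  have center: "\<Psi> (\<phi> f c) = c" "f \<in> carrier G" "c \<in> X" "shape \<Psi> c = F i"
    if "f \<in> F i" "c \<in> C i" for f c i
    using that by (auto simp: C_def shape_def)
  show ?thesis
  proof (rule that)
    show "\<exists>p\<in>X. F i = shape \<Psi> p \<and> F i \<noteq> {}" if "i \<in> {1..n}" for i
    proof -
      have "F i \<in> ?\<F>" using im that by blast
      then show ?thesis by auto
    qed
    show "C i \<in> A" for i
      using simple_shape[OF \<Psi>] by (simp add: C_def simple_def meas_def)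
    show "bij_betw (\<lambda>(i, f, c). \<phi> f c) (SIGMA i:{1..n}. F i \<times> C i) X"
      unfolding bij_betw_def
    proof
      show "inj_on (\<lambda>(i, f, c). \<phi> f c) (SIGMA i:{1..n}. F i \<times> C i)"
      proof (rule inj_onI)
        fix u v assume "u \<in> (SIGMA i:{1..n}. F i \<times> C i)" "v \<in> (SIGMA i:{1..n}. F i \<times> C i)"
          and uv: "(\<lambda>(i, f, c). \<phi> f c) u = (\<lambda>(i, f, c). \<phi> f c) v"
        then obtain i f c i' f' c' where u: "u = (i, f, c)" "v = (i', f', c')"
          and i: "i \<in> {1..n}" "f \<in> F i" "c \<in> C i" and i': "i' \<in> {1..n}" "f' \<in> F i'" "c' \<in> C i'"
          by auto
        have eq: "\<phi> f c = \<phi> f' c'" using uv u by simp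
        have c: "c = c'" using center(1)[OF i(2,3)] center(1)[OF i'(2,3)] eq by simp
        then have "F i = F i'" using center(4)[OF i(2,3)] center(4)[OF i'(2,3)] by simp
        then have "i = i'" by (rule inj_onD[OF inj _ i(1) i'(1)])
        moreover have "f = f'"
          using eq c act_inj center(2,3)[OF i(2,3)] center(2,3)[OF i'(2,3)] by simp
        ultimately show "u = v" using c u by simp
      qed
      show "(\<lambda>(i, f, c). \<phi> f c) ` (SIGMA i:{1..n}. F i \<times> C i) = X"
      proof (intro equalityI subsetI)
        fix x assume "x \<in> (\<lambda>(i, f, c). \<phi> f c) ` (SIGMA i:{1..n}. F i \<times> C i)"
        then obtain i f c where ifc: "f \<in> F i" "c \<in> C i" "x = \<phi> f c" by auto
        then show "x \<in> X" using center(2,3)[OF ifc(1,2)] by simp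
      next
        fix x assume x: "x \<in> X"
        let ?p = "\<Psi> x"
        have p: "?p \<in> X" using address_closed[OF \<Psi> x] .
        have "x \<in> act (shape \<Psi> ?p) {?p}"
          unfolding fiber_eq_act_shape[OF \<Psi> p, symmetric] using x by (simp add: mem_fiber)
        then obtain h where h: "h \<in> shape \<Psi> ?p" "x = \<phi> h ?p" by (auto simp: act_def)
        then have "shape \<Psi> ?p \<in> F ` {1..n}" unfolding im using p by auto
        then obtain i where i: "i \<in> {1..n}" "F i = shape \<Psi> ?p" by auto
        then have "(i, h, ?p) \<in> (SIGMA i:{1..n}. F i \<times> C i)" using h p by (auto simp: C_def)
        moreover have "x = (\<lambda>(i, f, c). \<phi> f c) (i, h, ?p)" using h by simp
        ultimately show "x \<in> (\<lambda>(i, f, c). \<phi> f c) ` (SIGMA i:{1..n}. F i \<times> C i)" by (rule rev_image_eqI)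
      qed
    qed
  qed
qed

section \<open>Thickening and carving\<close>

primrec set_pow :: "'g set \<Rightarrow> nat \<Rightarrow> 'g set" where
  "set_pow K 0 = {\<one>}"
| "set_pow K (Suc t) = K <#> set_pow K t"

lemma set_pow_carrier: "K \<subseteq> carrier G \<Longrightarrow> set_pow K t \<subseteq> carrier G"
  by (induction t) (simp_all add: set_mult_closed)

lemma finite_set_mult: "\<lbrakk>finite B; finite C\<rbrakk> \<Longrightarrow> finite (B <#> C)"
  by (simp add: set_mult_def)

lemma finite_set_pow: "finite K \<Longrightarrow> finite (set_pow K t)"
  by (induction t) (simp_all add: finite_set_mult)

lemma act_set_pow_Suc:
  "\<lbrakk>K \<subseteq> carrier G; U \<subseteq> X\<rbrakk> \<Longrightarrow> act (set_pow K (Suc t)) U = act K (act (set_pow K t) U)"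
  by (simp add: act_act set_pow_carrier)

lemma subset_act: "\<lbrakk>\<one> \<in> K; U \<subseteq> X\<rbrakk> \<Longrightarrow> U \<subseteq> act K U"
proof
  fix x assume a: "\<one> \<in> K" "U \<subseteq> X" "x \<in> U"
  then have "x = \<phi> \<one> x" by auto
  then show "x \<in> act K U" using a actI by metis
qed

lemma act_set_pow_mono:
  assumes "K \<subseteq> carrier G" "\<one> \<in> K" "U \<subseteq> X" "t \<le> t'"
  shows "act (set_pow K t) U \<subseteq> act (set_pow K t') U"
  using assms(4)
proof (induction rule: dec_induct)
  case (step n)
  have "act (set_pow K n) U \<subseteq> act (set_pow K (Suc n)) U"
    unfolding act_set_pow_Suc[OF assms(1,3)]
    by (intro subset_act assms act_subset set_pow_carrier)
  then show ?case using step by auto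
qed simp

lemma finite_act_fiber: "\<lbrakk>address f; finite B\<rbrakk> \<Longrightarrow> finite (act B (fiber f p))"
  by (simp add: finite_act)

lemma fiber_subset: "fiber f p \<subseteq> X"
  by (auto simp: fiber_def)

text \<open>Every class of a partition of low dimension is thickened to a neighbourhood with small boundary;
  overlaps are resolved by giving a point to the class of least color. Hence a cut between two new
  classes lies on the boundary of a thickened class, and the thickened classes have bounded
  multiplicity.\<close>

lemma carving:
  assumes asd: "asd_le d" and K: "finite K" "K \<subseteq> carrier G" "\<one> \<in> K" "\<And>k. k \<in> K \<Longrightarrow> inv k \<in> K"
    and r: "0 < r"
  obtains \<rho> Q where "address \<rho>" "finite Q" "Q \<subseteq> carrier G"
    "\<And>V. \<lbrakk>finite V; V \<subseteq> X\<rbrakk> \<Longrightarrow>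
       r * card {x \<in> V. \<exists>k\<in>K. \<rho> (\<phi> k x) \<noteq> \<rho> x} \<le> card K * (d + 1) * card (act Q V)"
proof -
  let ?P = "set_pow K r"
  \<comment> \<open>A point \<open>x\<close> lies in the \<open>?P\<close>-thickening of a class
    exactly if \<open>act ?S {x}\<close> meets the class, so the dimension at scale
    \<open>?S\<close> bounds the multiplicity of the thickenings.\<close>
  let ?S = "(\<lambda>g. inv g) ` ?P"
  have P: "finite ?P" "?P \<subseteq> carrier G" using K by (simp_all add: finite_set_pow set_pow_carrier)
  have S: "finite ?S" "?S \<subseteq> carrier G" using P by auto
  obtain e where e: "address e" and mult: "\<And>x. x \<in> X \<Longrightarrow> card (e ` act ?S {x}) \<le> d + 1"
    using asd S unfolding asd_le_def by metis
  obtain B where B: "finite B" "B \<subseteq> carrier G" "\<And>x. x \<in> X \<Longrightarrow> \<exists>b\<in>B. x = \<phi> b (e x)"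
    "\<And>x. x \<in> X \<Longrightarrow> \<exists>b\<in>B. e x = \<phi> b x"
    using address_bounded[OF e] by (metis (no_types, lifting))
  define N where "N t p = act (set_pow K t) (fiber e p)" for t p
  have N_sub: "N t p \<subseteq> X" for t p
    unfolding N_def by (intro act_subset set_pow_carrier K fiber_subset)
  have N_fin: "finite (N t p)" for t p
    unfolding N_def by (intro finite_act_fiber e finite_set_pow K)
  have N_mono: "N t p \<subseteq> N t' p" if "t \<le> t'" for t t' p
    unfolding N_def by (intro act_set_pow_mono K fiber_subset that)
  have N_Suc: "\<phi> k x \<in> N (Suc t) p" if "k \<in> K" "x \<in> N t p" for k x t p
    using that unfolding N_def act_set_pow_Suc[OF K(2) fiber_subset] by (intro actI)
  have mem_N: "x \<in> N t p \<longleftrightarrow> (\<exists>q\<in>set_pow K t. e (\<phi> (inv q) x) = p)" if x: "x \<in> X" for x t p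
  proof
    assume "x \<in> N t p"
    then obtain q y where q: "q \<in> set_pow K t" "y \<in> X" "e y = p" "x = \<phi> q y"
      by (auto simp: N_def act_def mem_fiber)
    then have "\<phi> (inv q) x = y" using set_pow_carrier[OF K(2), of t] by auto
    then show "\<exists>q\<in>set_pow K t. e (\<phi> (inv q) x) = p" using q(1,3) by (intro bexI[of _ q]) simp_all
  next
    assume "\<exists>q\<in>set_pow K t. e (\<phi> (inv q) x) = p"
    then obtain q where q: "q \<in> set_pow K t" "e (\<phi> (inv q) x) = p" by auto
    then have qG: "q \<in> carrier G" using set_pow_carrier[OF K(2), of t] by auto
    then have "\<phi> q (\<phi> (inv q) x) \<in> N t p"
      unfolding N_def using q x by (intro actI) (auto simp: mem_fiber)
    then show "x \<in> N t p" using qG x by simp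
  qed
  have lab: "p \<in> e ` act ?S {x}" if xN: "x \<in> N r p" for x p
  proof -
    have x: "x \<in> X" using xN N_sub by auto
    then obtain q where q: "q \<in> ?P" "e (\<phi> (inv q) x) = p"
      using xN unfolding mem_N[OF x] by auto
    have "\<phi> (inv q) x \<in> act ?S {x}" by (intro actI) (use q in auto)
    then show ?thesis using q by auto
  qed
  \<comment> \<open>Counting in the group shows that the sizes of the thickenings, and with them the
    radius \<open>\<tau> p\<close>, depend only on the shape of the fiber. This is what makes
    \<open>\<tau>\<close> simple.\<close>
  define c where "c p t = card (set_pow K t <#> shape e p)" for p t
  have c: "c p t = card (N t p)" if "p \<in> X" for p t
    unfolding c_def N_def fiber_eq_act_shape[OF e that]
    using that K by (simp add: act_act card_act_point set_pow_carrier shape_carrier set_mult_closed)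
  define \<tau> where "\<tau> p = (LEAST t. r * (c p (Suc t) - c p t) \<le> c p r)" for p
  have \<tau>: "\<tau> p < r" "r * card (N (Suc (\<tau> p)) p - N (\<tau> p) p) \<le> card (N r p)" if p: "p \<in> X" for p
  proof -
    have "mono (c p)"
      by (intro monoI) (simp add: c[OF p] card_mono N_fin N_mono)
    from ex_small_increment[OF this r] obtain t where t: "t < r" "r * (c p (Suc t) - c p t) \<le> c p r"
      by auto
    have "\<tau> p \<le> t" unfolding \<tau>_def by (rule Least_le) (rule t)
    then show "\<tau> p < r" using t by simp
    have "r * (c p (Suc (\<tau> p)) - c p (\<tau> p)) \<le> c p r"
      unfolding \<tau>_def by (rule LeastI) (rule t)
    then show "r * card (N (Suc (\<tau> p)) p - N (\<tau> p) p) \<le> card (N r p)"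
      by (simp add: c[OF p] card_Diff_subset N_fin N_mono)
  qed
  have simple_\<tau>: "simple \<tau>"
    unfolding \<tau>_def c_def
    by (rule simple_comp[of _ "\<lambda>s. LEAST t. r * (card (set_pow K (Suc t) <#> s) - card (set_pow K t <#> s))
           \<le> card (set_pow K r <#> s)"]) (rule simple_shape[OF e])
  have meas_N: "meas (\<lambda>x. x \<in> N (\<tau> (f x)) (f x))" if f: "address f" for f
  proof (rule meas_simple[OF simple_address[OF simple_\<tau> f], of "\<lambda>t x. x \<in> N t (f x)"])
    fix t
    have "meas (\<lambda>x. \<exists>q\<in>set_pow K t. e (\<phi> (inv q) x) = f x)"
    proof (rule meas_bex)
      show "finite (set_pow K t)" using K finite_set_pow by simp
      fix q assume "q \<in> set_pow K t"
      then have "inv q \<in> carrier G" using set_pow_carrier[OF K(2), of t] by auto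
      then show "meas (\<lambda>x. e (\<phi> (inv q) x) = f x)"
        by (intro meas_address_eq f address_comp[OF e] address_act)
    qed
    then show "meas (\<lambda>x. x \<in> N t (f x))" by (rule meas_cong) (simp add: mem_N)
  qed
  \<comment> \<open>\<open>K\<close> leads to a neighbour of \<open>x\<close>, \<open>?S\<close>
    into a class whose thickening may contain that neighbour, and \<open>B\<close> to the label of
    the class. So labels competing at \<open>x\<close> or at a neighbour all lie in
    \<open>act ?C {x}\<close>, where colors are distinct.\<close>
  let ?C = "B <#> (?S <#> K)"
  have C: "finite ?C" "?C \<subseteq> carrier G"
    using B S K by (simp_all add: finite_set_mult set_mult_closed)
  obtain \<kappa> :: "'x \<Rightarrow> nat" where \<kappa>: "\<And>x. x \<in> X \<Longrightarrow> inj_on \<kappa> (act ?C {x})"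
    "\<And>f g. \<lbrakk>address f; address g\<rbrakk> \<Longrightarrow> meas (\<lambda>x. \<kappa> (f x) \<le> \<kappa> (g x))"
    by (rule coloring_inj[OF C]) (rule that)
  \<comment> \<open>Any class whose thickening contains \<open>x\<close> has its label among the
    \<open>cand s x\<close>, so taking the least color is a choice from a finite index set.\<close>
  define cand where "cand s x = e (\<phi> s x)" for s x
  have cand: "address (cand s)" if "s \<in> ?S" for s
    unfolding cand_def by (rule address_comp[OF e address_act]) (use that S in auto)
  define W where "W p x \<longleftrightarrow> x \<in> N (\<tau> p) p" for p x
  define best where "best s x \<longleftrightarrow> W (cand s x) x \<and>
    (\<forall>s'\<in>?S. W (cand s' x) x \<longrightarrow> \<kappa> (cand s x) \<le> \<kappa> (cand s' x))" for s x
  have best_meas: "meas (best s)" if "s \<in> ?S" for s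
    unfolding best_def W_def
    by (rule meas_conj[OF meas_N meas_ball[OF S(1) meas_imp]]; (rule meas_N \<kappa>(2))?; (intro cand that)?; assumption?)
  have WN: "x \<in> N r p" if "W p x" "p \<in> X" for p x
    using that \<tau>(1)[of p] N_mono[of "\<tau> p" r p] unfolding W_def by auto
  have W_cand: "\<exists>s\<in>?S. cand s x = p" if "W p x" "p \<in> X" for p x
    using lab[OF WN[OF that]] by (auto simp: act_def cand_def)
  have best_ex: "\<exists>s\<in>?S. best s x" if x: "x \<in> X" for x
  proof -
    let ?T = "{s \<in> ?S. W (cand s x) x}"
    have "x \<in> N 0 (e x)" using x by (simp add: mem_N)
    then have "W (e x) x" unfolding W_def using N_mono[of 0] by auto
    then obtain s where "s \<in> ?S" "cand s x = e x"
      using W_cand[of "e x" x] address_closed[OF e x] by blast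
    then have "s \<in> ?T" using \<open>W (e x) x\<close> by simp
    then have "?T \<noteq> {}" by blast
    moreover have "finite ?T" using S by simp
    ultimately obtain s where "s \<in> ?T" "\<forall>s'\<in>?T. \<kappa> (cand s x) \<le> \<kappa> (cand s' x)"
      using ex_min_if_finite[of "(\<lambda>s. \<kappa> (cand s x)) ` ?T"] by (auto simp: not_less)
    then show ?thesis by (auto simp: best_def)
  qed
  obtain \<rho> where \<rho>: "address \<rho>" "\<And>x. x \<in> X \<Longrightarrow> \<exists>s\<in>?S. best s x \<and> \<rho> x = cand s x"
    by (rule address_select[OF S(1), of cand best, OF cand best_meas best_ex]) (assumption+, rule that)
  have \<rho>_X: "\<rho> x \<in> X" if "x \<in> X" for x using address_closed[OF \<rho>(1) that] .
  have \<rho>W: "W (\<rho> x) x" if "x \<in> X" for x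
    using \<rho>(2)[OF that] by (auto simp: best_def)
  have \<rho>_least: "\<kappa> (\<rho> x) \<le> \<kappa> p" if "x \<in> X" "W p x" "p \<in> X" for x p
    using \<rho>(2)[OF that(1)] W_cand[OF that(2,3)] that(2) by (auto simp: best_def)
  have \<rho>C: "\<rho> (\<phi> k x) \<in> act ?C {x}" if x: "x \<in> X" and k: "k \<in> K" for x k
  proof -
    have kx: "\<phi> k x \<in> X" using k x K(2) by auto
    obtain s where s: "s \<in> ?S" "\<rho> (\<phi> k x) = e (\<phi> s (\<phi> k x))"
      using \<rho>(2)[OF kx] by (auto simp: cand_def)
    have sk: "\<phi> s (\<phi> k x) \<in> act ?S (act K {x})" by (intro actI s k) simp
    have "\<phi> s (\<phi> k x) \<in> X" using s S kx by auto
    then obtain b where "b \<in> B" "e (\<phi> s (\<phi> k x)) = \<phi> b (\<phi> s (\<phi> k x))" using B(4) by metis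
    then have "\<rho> (\<phi> k x) \<in> act B (act ?S (act K {x}))" using s sk by (simp add: actI)
    then show ?thesis using x B S K by (simp add: act_act act_subset set_mult_closed)
  qed
  define Z where "Z = (\<Union>p\<in>X. N (Suc (\<tau> p)) p - N (\<tau> p) p)"
  \<comment> \<open>Different labels here have different colors. The thickening of the lower color
    cannot contain the other endpoint, which would have preferred it; but one further step of
    \<open>K\<close> reaches that endpoint, so it lies in the shell.\<close>
  have cut: "x \<in> Z \<or> \<phi> k x \<in> Z" if x: "x \<in> X" and k: "k \<in> K" and ne: "\<rho> (\<phi> k x) \<noteq> \<rho> x" for x k
  proof -
    have kx: "\<phi> k x \<in> X" "k \<in> carrier G" using k x K(2) by auto
    let ?p = "\<rho> x" and ?p' = "\<rho> (\<phi> k x)"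
    have p: "?p \<in> X" "?p' \<in> X" using \<rho>_X x kx by auto
    have "?p \<in> act ?C {x}" using \<rho>C[OF x K(3)] x by simp
    then have "\<kappa> ?p \<noteq> \<kappa> ?p'" using \<kappa>(1)[OF x] \<rho>C[OF x k] ne by (auto dest: inj_onD)
    then consider "\<kappa> ?p < \<kappa> ?p'" | "\<kappa> ?p' < \<kappa> ?p" by linarith
    then show ?thesis
    proof cases
      case 1
      then have "\<not> W ?p (\<phi> k x)" using \<rho>_least[OF kx(1) _ p(1)] by auto
      moreover have "\<phi> k x \<in> N (Suc (\<tau> ?p)) ?p" using N_Suc[OF k] \<rho>W[OF x] by (simp add: W_def)
      ultimately show ?thesis using p by (auto simp: Z_def W_def)
    next
      case 2
      then have "\<not> W ?p' x" using \<rho>_least[OF x _ p(2)] by auto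
      moreover have "\<phi> (inv k) (\<phi> k x) \<in> N (Suc (\<tau> ?p')) ?p'"
        using N_Suc[OF K(4)[OF k]] \<rho>W[OF kx(1)] by (simp add: W_def)
      ultimately show ?thesis using p kx x by (auto simp: Z_def W_def)
    qed
  qed
  \<comment> \<open>Read from right to left: from a point of \<open>V\<close> into a class it sees,
    on to the label, out to the whole class, and out to its largest thickening.\<close>
  let ?Q0 = "?P <#> (B <#> (B <#> ?S))"
  have Q0: "finite ?Q0" "?Q0 \<subseteq> carrier G"
    using P B S by (simp_all add: finite_set_mult set_mult_closed)
  have Z_count: "r * card (Z \<inter> V) \<le> (d + 1) * card (act ?Q0 V)" if V: "finite V" "V \<subseteq> X" for V
  proof -
    define P0 where "P0 = {p \<in> X. N r p \<inter> V \<noteq> {}}"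
    have P0_sub: "P0 \<subseteq> e ` act ?S V"
    proof
      fix p assume "p \<in> P0"
      then obtain v where "v \<in> V" "v \<in> N r p" by (auto simp: P0_def)
      then have "p \<in> e ` act ?S {v}" using lab by simp
      then show "p \<in> e ` act ?S V" using act_mono[of ?S ?S "{v}" V] \<open>v \<in> V\<close> by auto
    qed
    have P0: "finite P0" by (rule finite_subset[OF P0_sub]) (use S V in \<open>simp add: finite_act\<close>)
    have sub: "N r p \<subseteq> act ?Q0 V" if pP: "p \<in> P0" for p
    proof -
      obtain y where y: "y \<in> act ?S V" "p = e y" using subsetD[OF P0_sub pP] by auto
      have yX: "y \<in> X" using y act_subset[OF S(2) V(2)] by auto
      have "p \<in> act B (act ?S V)" using B(4)[OF yX] y by (auto intro: actI)
      then have "fiber e p \<subseteq> act B (act B (act ?S V))"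
      proof (intro subsetI)
        fix x assume p: "p \<in> act B (act ?S V)" and "x \<in> fiber e p"
        then have "x \<in> X" "e x = p" by (auto simp: mem_fiber)
        then obtain b where "b \<in> B" "x = \<phi> b p" using B(3)[of x] by auto
        then show "x \<in> act B (act B (act ?S V))" using p by (simp add: actI)
      qed
      then have "N r p \<subseteq> act ?P (act B (act B (act ?S V)))"
        unfolding N_def by (intro act_mono) auto
      then show ?thesis using V P B S by (simp add: act_act act_subset set_mult_closed)
    qed
    have "Z \<inter> V \<subseteq> (\<Union>p\<in>P0. N (Suc (\<tau> p)) p - N (\<tau> p) p)"
    proof
      fix x assume "x \<in> Z \<inter> V"
      then obtain p where p: "p \<in> X" "x \<in> N (Suc (\<tau> p)) p - N (\<tau> p) p" "x \<in> V" by (auto simp: Z_def)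
      have "x \<in> N r p" using p N_mono[of "Suc (\<tau> p)" r p] \<tau>(1)[OF p(1)] by auto
      then show "x \<in> (\<Union>p\<in>P0. N (Suc (\<tau> p)) p - N (\<tau> p) p)" using p by (auto simp: P0_def)
    qed
    then have "card (Z \<inter> V) \<le> card (\<Union>p\<in>P0. N (Suc (\<tau> p)) p - N (\<tau> p) p)"
      by (intro card_mono finite_UN_I P0) (auto simp: N_fin)
    also have "\<dots> \<le> (\<Sum>p\<in>P0. card (N (Suc (\<tau> p)) p - N (\<tau> p) p))"
      by (rule card_UN_le[OF P0])
    finally have "r * card (Z \<inter> V) \<le> (\<Sum>p\<in>P0. r * card (N (Suc (\<tau> p)) p - N (\<tau> p) p))"
      unfolding sum_distrib_left[symmetric] by (rule mult_left_mono) simp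
    \<comment> \<open>Each shell is charged to the full thickening \<open>N r p\<close>; a point
      belongs to at most \<open>d + 1\<close> of these.\<close>
    also have "\<dots> \<le> (\<Sum>p\<in>P0. card (N r p))"
      by (rule sum_mono) (use \<tau>(2) in \<open>simp add: P0_def\<close>)
    also have "\<dots> \<le> (d + 1) * card (act ?Q0 V)"
    proof (rule double_counting[OF P0 _ sub])
      show "finite (act ?Q0 V)" using Q0 V by (simp add: finite_act)
      fix y assume "y \<in> act ?Q0 V"
      then have y: "y \<in> X" using act_subset[OF Q0(2) V(2)] by auto
      have "card {p \<in> P0. y \<in> N r p} \<le> card (e ` act ?S {y})"
        using lab S by (intro card_mono) (auto simp: finite_act)
      then show "card {p \<in> P0. y \<in> N r p} \<le> d + 1" using mult[OF y] by simp
    qed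
    finally show ?thesis .
  qed
  show ?thesis
  proof (rule that[OF \<rho>(1), of "?Q0 <#> K"])
    show "finite (?Q0 <#> K)" "?Q0 <#> K \<subseteq> carrier G"
      using Q0 K by (simp_all add: finite_set_mult set_mult_closed)
    fix V assume V: "finite V" "V \<subseteq> X"
    have KV: "finite (act K V)" "act K V \<subseteq> X" using V K by (simp_all add: finite_act act_subset)
    let ?Y = "{x \<in> V. \<exists>k\<in>K. \<rho> (\<phi> k x) \<noteq> \<rho> x}"
    \<comment> \<open>A cut point lies in a shell or is one step of \<open>K\<close> away from a
      shell point. This costs the factor \<open>card K\<close> and the additional \<open>K\<close>
      in \<open>?Q0 <#> K\<close>.\<close>
    have "?Y \<subseteq> act K (Z \<inter> act K V)"
    proof
      fix x assume "x \<in> ?Y"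
      then obtain k where k: "x \<in> V" "k \<in> K" "\<rho> (\<phi> k x) \<noteq> \<rho> x" by auto
      then have x: "x \<in> X" "k \<in> carrier G" using V K by auto
      from cut[OF x(1) k(2,3)] show "x \<in> act K (Z \<inter> act K V)"
      proof
        assume "x \<in> Z"
        then have "x \<in> Z \<inter> act K V" using subset_act[OF K(3) V(2)] k by auto
        then have "\<phi> \<one> x \<in> act K (Z \<inter> act K V)" by (rule actI[OF K(3)])
        then show ?thesis using x by simp
      next
        assume "\<phi> k x \<in> Z"
        then have "\<phi> k x \<in> Z \<inter> act K V" using actI[OF k(2,1)] by simp
        then have "\<phi> (inv k) (\<phi> k x) \<in> act K (Z \<inter> act K V)" by (rule actI[OF K(4)[OF k(2)]])
        then show ?thesis using x by simp
      qed
    qed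
    then have "card ?Y \<le> card (act K (Z \<inter> act K V))"
      by (rule card_mono[rotated]) (intro finite_act K finite_Int disjI2 KV)
    also have "\<dots> \<le> card K * card (Z \<inter> act K V)" by (intro card_act_le K finite_Int disjI2 KV)
    finally have "r * card ?Y \<le> card K * (r * card (Z \<inter> act K V))"
      unfolding mult.left_commute[of "card K"] by (rule mult_left_mono) simp
    also have "\<dots> \<le> card K * ((d + 1) * card (act ?Q0 (act K V)))"
      by (rule mult_left_mono[OF Z_count[OF KV]]) simp
    also have "act ?Q0 (act K V) = act (?Q0 <#> K) V" by (rule act_act[OF Q0(2) K(2) V(2)])
    finally show "r * card ?Y \<le> card K * (d + 1) * card (act (?Q0 <#> K) V)"
      by (simp only: mult.assoc)
  qed
qed

end

section \<open>Bad pieces and their sparseness\<close>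

text \<open>The fiberwise inequalities are summed. Used directly to pass from single pieces to
  unions of pieces, and contrapositively to find a coset on which a ratio is small.\<close>

lemma card_le_by_fibers:
  assumes "finite Y" "finite Z"
    and "\<And>p. a * card {x \<in> Y. f x = p} \<le> b * card {x \<in> Z. f x = p}"
  shows "a * card Y \<le> (b::nat) * card Z"
proof -
  let ?T = "f ` (Y \<union> Z)"
  have *: "card S = (\<Sum>p\<in>?T. card {x \<in> S. f x = p})" if "S = Y \<or> S = Z" for S
  proof -
    have S: "finite S" "f ` S \<subseteq> ?T" using assms(1,2) that by auto
    have "finite ?T" using assms(1,2) by simp
    from sum.group[OF S(1) this S(2), of "\<lambda>_. 1::nat"] show ?thesis by simp
  qed
  have "a * card Y = (\<Sum>p\<in>?T. a * card {x \<in> Y. f x = p})"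
    using *[of Y] by (simp add: sum_distrib_left)
  also have "\<dots> \<le> (\<Sum>p\<in>?T. b * card {x \<in> Z. f x = p})" by (rule sum_mono) (rule assms(3))
  also have "\<dots> = b * card Z" using *[of Z] by (simp add: sum_distrib_left)
  finally show ?thesis .
qed

context measured_action
begin

lemma meas_simple2: "\<lbrakk>simple s; simple t\<rbrakk> \<Longrightarrow> meas (\<lambda>x. Q (s x) (t x))"
  by (rule meas_simple[of s "\<lambda>v x. Q v (t x)"]) (auto intro: meas_comp)

text \<open>\<open>U\<close> marks the points of bad pieces. Their number in \<open>V\<close> is
  controlled only through an enlargement of \<open>V\<close> that depends on \<open>\<rho>\<close>;
  \<open>W\<close> is chosen afterwards, so that enlarging its translates costs at most a factor
  2.\<close>

lemma ex_sparse_cuts: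
  assumes asd: "asd_le d" and K: "finite K" "K \<subseteq> carrier G" "\<one> \<in> K" "\<And>k. k \<in> K \<Longrightarrow> inv k \<in> K"
    and amenable: "\<And>Q. \<lbrakk>finite Q; Q \<subseteq> carrier G\<rbrakk> \<Longrightarrow>
      \<exists>W. finite W \<and> W \<noteq> {} \<and> W \<subseteq> carrier G \<and> card (Q <#> W) \<le> 2 * card W"
    and m: "0 < m" and q: "0 < q"
  obtains \<rho> U W where "address \<rho>" "meas U"
    "\<And>x y. \<lbrakk>x \<in> X; y \<in> X; \<rho> x = \<rho> y\<rbrakk> \<Longrightarrow> U x \<longleftrightarrow> U y"
    "\<And>x. \<lbrakk>x \<in> X; \<not> U x\<rbrakk> \<Longrightarrow>
       m * card {y \<in> fiber \<rho> (\<rho> x). \<exists>k\<in>K. \<rho> (\<phi> k y) \<noteq> \<rho> y} \<le> card (fiber \<rho> (\<rho> x))"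
    "finite W" "W \<noteq> {}" "W \<subseteq> carrier G"
    "\<And>y. y \<in> X \<Longrightarrow> q * card {w \<in> W. U (\<phi> w y)} \<le> card W"
proof -
  \<comment> \<open>The scale \<open>D * (2 * q * m)\<close> has one factor per loss:
    \<open>D\<close> cancels the constant of the carving, \<open>m\<close> pays for passing from cut
    points to bad points, 2 for the growth of \<open>W\<close>, and \<open>q\<close> is the
    sparseness that remains.\<close>
  define D where "D = card K * (d + 1)"
  have D: "0 < D" using K by (auto simp: D_def card_gt_0_iff)
  obtain \<rho> Q where \<rho>: "address \<rho>" and Q: "finite Q" "Q \<subseteq> carrier G"
    and count: "\<And>V. \<lbrakk>finite V; V \<subseteq> X\<rbrakk> \<Longrightarrow>
       D * (2 * q * m) * card {x \<in> V. \<exists>k\<in>K. \<rho> (\<phi> k x) \<noteq> \<rho> x} \<le> card K * (d + 1) * card (act Q V)"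
    by (rule carving[OF asd K, of "D * (2 * q * m)"]) (assumption, (use D m q in simp), rule that)
  define cut where "cut x \<longleftrightarrow> (\<exists>k\<in>K. \<rho> (\<phi> k x) \<noteq> \<rho> x)" for x
  have cut_count: "2 * q * m * card {x \<in> V. cut x} \<le> card (act Q V)" if "finite V" "V \<subseteq> X" for V
    using count[OF that] D unfolding cut_def D_def[symmetric] by (simp only: mult.assoc) simp
  have meas_cut: "meas cut" unfolding cut_def
  proof (rule meas_bex[OF K(1)], rule meas_not)
    fix k assume "k \<in> K"
    then show "meas (\<lambda>x. \<rho> (\<phi> k x) = \<rho> x)"
      by (intro meas_address_eq \<rho> address_comp[OF \<rho>] address_act) (use K in auto)
  qed
  define bad where "bad p \<longleftrightarrow> card (fiber \<rho> p) \<le> m * card {x \<in> fiber \<rho> p. cut x}" for p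
  have simple1: "simple (\<lambda>p. {h \<in> shape \<rho> p. cut (\<phi> h p)})"
  proof (rule simple_subst[OF simple_shape[OF \<rho>], of "\<lambda>v p. {h \<in> v. cut (\<phi> h p)}"])
    fix v assume "v \<in> shape \<rho> ` X"
    then have v: "finite v" "v \<subseteq> carrier G" using finite_shape[OF \<rho>] shape_carrier by auto
    show "simple (\<lambda>p. {h \<in> v. cut (\<phi> h p)})"
      by (rule simple_Collect[OF v(1)], rule meas_translate[OF _ meas_cut]) (use v in auto)
  qed
  \<comment> \<open>Counts in the fiber become counts in the shape, so badness is decided by simple
    functions of \<open>p\<close>.\<close>
  have bad_alt: "bad p \<longleftrightarrow> card (shape \<rho> p) \<le> m * card {h \<in> shape \<rho> p. cut (\<phi> h p)}"
    if p: "p \<in> X" for p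
  proof -
    have "{x \<in> fiber \<rho> p. cut x} = act {h \<in> shape \<rho> p. cut (\<phi> h p)} {p}"
      unfolding fiber_eq_act_shape[OF \<rho> p] by (auto simp: act_def)
    moreover have "card (act {h \<in> shape \<rho> p. cut (\<phi> h p)} {p}) = card {h \<in> shape \<rho> p. cut (\<phi> h p)}"
      by (rule card_act_point[OF _ p]) (auto simp: shape_def)
    ultimately show ?thesis by (simp add: bad_def card_fiber[OF \<rho> p])
  qed
  have meas_bad: "meas bad"
    by (rule meas_cong[OF meas_simple2[OF simple_shape[OF \<rho>] simple1, of "\<lambda>s t. card s \<le> m * card t"]])
      (simp add: bad_alt)
  define U where "U x \<longleftrightarrow> bad (\<rho> x)" for x
  obtain B where B: "finite B" "B \<subseteq> carrier G" "\<And>x. x \<in> X \<Longrightarrow> \<exists>b\<in>B. x = \<phi> b (\<rho> x)"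
    "\<And>x. x \<in> X \<Longrightarrow> \<exists>b\<in>B. \<rho> x = \<phi> b x"
    by (rule address_bounded[OF \<rho>]) (rule that)
  have U_count: "2 * q * card {x \<in> V. U x} \<le> card (act (Q <#> (B <#> B)) V)"
    if V: "finite V" "V \<subseteq> X" for V
  proof -
    let ?V = "act (B <#> B) V"
    have BB: "finite (B <#> B)" "B <#> B \<subseteq> carrier G"
      using B by (simp_all add: finite_set_mult set_mult_closed)
    have V': "finite ?V" "?V \<subseteq> X"
      using V BB by (simp_all add: finite_act act_subset)
    \<comment> \<open>A bad piece that meets \<open>V\<close> lies inside \<open>?V\<close>, and its
      size is at most \<open>m\<close> times the number of its cut points, which are all counted on
      the right.\<close>
    have "1 * card {x \<in> V. U x} \<le> m * card {x \<in> ?V. cut x}"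
    proof (rule card_le_by_fibers[where f = \<rho>])
      fix p
      show "1 * card {x \<in> {x \<in> V. U x}. \<rho> x = p} \<le> m * card {x \<in> {x \<in> ?V. cut x}. \<rho> x = p}"
      proof (cases "{x \<in> {x \<in> V. U x}. \<rho> x = p} = {}")
        case False
        then obtain x where x: "x \<in> V" "U x" "\<rho> x = p" by blast
        have "fiber \<rho> p \<subseteq> ?V"
        proof
          fix y assume "y \<in> fiber \<rho> p"
          then have y: "y \<in> X" "\<rho> y = p" by (auto simp: mem_fiber)
          obtain b where b: "b \<in> B" "p = \<phi> b x" using B(4)[of x] x V by auto
          obtain c where c: "c \<in> B" "y = \<phi> c p" using B(3)[OF y(1)] y(2) by auto
          have "y \<in> act B (act B V)" unfolding c b(2) by (intro actI c b x)
          then show "y \<in> ?V" using act_act[OF B(2) B(2) V(2)] by simp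
        qed
        then have sub: "{x \<in> fiber \<rho> p. cut x} \<subseteq> {x \<in> {x \<in> ?V. cut x}. \<rho> x = p}"
          by (auto simp: mem_fiber)
        have "card {x \<in> {x \<in> V. U x}. \<rho> x = p} \<le> card (fiber \<rho> p)"
          using V by (intro card_mono finite_fiber \<rho>) (auto simp: mem_fiber)
        also have "\<dots> \<le> m * card {x \<in> fiber \<rho> p. cut x}"
          using x by (simp add: U_def bad_def)
        also have "\<dots> \<le> m * card {x \<in> {x \<in> ?V. cut x}. \<rho> x = p}"
          by (intro mult_left_mono card_mono sub) (use V' in auto)
        finally show ?thesis by simp
      qed (simp only: card.empty)
    qed (use V V' in auto)
    then have "2 * q * card {x \<in> V. U x} \<le> 2 * q * (m * card {x \<in> ?V. cut x})"
      by (intro mult_left_mono) simp_all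
    also have "\<dots> \<le> card (act Q ?V)" using cut_count[OF V'] by (simp add: mult.assoc)
    finally show ?thesis using act_act[OF Q(2) BB(2) V(2)] by simp
  qed
  \<comment> \<open>\<open>Q\<close> and \<open>B\<close> are fixed by now. The doubling constant 2
    cancels against the factor 2 in \<open>U_count\<close>.\<close>
  obtain W where W: "finite W" "W \<noteq> {}" "W \<subseteq> carrier G" "card (Q <#> (B <#> B) <#> W) \<le> 2 * card W"
    using amenable[of "Q <#> (B <#> B)"] Q B by (auto simp: finite_set_mult set_mult_closed)
  have QB: "Q <#> (B <#> B) \<subseteq> carrier G" using Q B by (simp add: set_mult_closed)
  show ?thesis
  proof (rule that[of \<rho> U W, OF \<rho> _ _ _ W(1-3)])
    show "meas U" unfolding U_def by (rule meas_address[OF \<rho> meas_bad])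
    show "U x \<longleftrightarrow> U y" if "\<rho> x = \<rho> y" for x y using that by (simp add: U_def)
    show "m * card {y \<in> fiber \<rho> (\<rho> x). \<exists>k\<in>K. \<rho> (\<phi> k y) \<noteq> \<rho> y} \<le> card (fiber \<rho> (\<rho> x))"
      if "\<not> U x" for x
      using that by (simp add: U_def bad_def cut_def[symmetric])
    fix y assume y: "y \<in> X"
    have inj: "inj_on (\<lambda>w. \<phi> w y) W"
      using W(3) y by (intro inj_onI) (auto simp: act_inj subset_iff)
    have "{x \<in> act W {y}. U x} = (\<lambda>w. \<phi> w y) ` {w \<in> W. U (\<phi> w y)}" by (auto simp: act_def)
    then have eq: "card {x \<in> act W {y}. U x} = card {w \<in> W. U (\<phi> w y)}"
      using inj by (simp add: card_image inj_on_subset)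
    have "2 * q * card {w \<in> W. U (\<phi> w y)} \<le> card (act (Q <#> (B <#> B)) (act W {y}))"
      unfolding eq[symmetric] by (rule U_count) (use W y in \<open>auto simp: finite_act act_def\<close>)
    also have "\<dots> = card (act (Q <#> (B <#> B) <#> W) {y})"
      using act_act[OF QB W(3), of "{y}"] y by simp
    also have "\<dots> = card (Q <#> (B <#> B) <#> W)"
      by (rule card_act_point[OF set_mult_closed[OF QB W(3)] y])
    finally show "q * card {w \<in> W. U (\<phi> w y)} \<le> card W" using W(4) by simp
  qed
qed

section \<open>Absorbing the bad pieces\<close>

text \<open>The bad part of the carved partition occupies a small fraction of every translate of \<open>W\<close>, so a
  bad point can be moved by \<open>W W\<^sup>-\<^sup>1\<close> into the good part in almost all ways; it joins the coarse class
  which receives the largest share of these moves. Counting the moves backwards shows that no coarse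
  class absorbs many bad points.\<close>

lemma ex_invariant_address:
  assumes asd: "asd_le d" and K: "finite K" "K \<subseteq> carrier G" "\<one> \<in> K" "\<And>k. k \<in> K \<Longrightarrow> inv k \<in> K"
    and amenable: "\<And>Q. \<lbrakk>finite Q; Q \<subseteq> carrier G\<rbrakk> \<Longrightarrow>
      \<exists>W. finite W \<and> W \<noteq> {} \<and> W \<subseteq> carrier G \<and> card (Q <#> W) \<le> 2 * card W"
    and m: "0 < m"
  obtains \<Psi> where "address \<Psi>"
    "\<And>p. m * card (act K (fiber \<Psi> p) - fiber \<Psi> p) \<le> 2 * card K * card (fiber \<Psi> p)"
proof -
  \<comment> \<open>\<open>m\<close> is the wanted ratio of good points to absorbed bad points in a
    class; \<open>2 * (d + 1)\<close> compensates for the share of the moves that the chosen class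
    is guaranteed.\<close>
  define q where "q = 2 * (d + 1) * m"
  have q: "0 < q" "2 \<le> q" using m by (auto simp: q_def)
  obtain \<rho> U W where \<rho>: "address \<rho>" and meas_U: "meas U"
    and U_sat: "\<And>x y. \<lbrakk>x \<in> X; y \<in> X; \<rho> x = \<rho> y\<rbrakk> \<Longrightarrow> U x \<longleftrightarrow> U y"
    and good_cut: "\<And>x. \<lbrakk>x \<in> X; \<not> U x\<rbrakk> \<Longrightarrow>
       m * card {y \<in> fiber \<rho> (\<rho> x). \<exists>k\<in>K. \<rho> (\<phi> k y) \<noteq> \<rho> y} \<le> card (fiber \<rho> (\<rho> x))"
    and W: "finite W" "W \<noteq> {}" "W \<subseteq> carrier G"
    and sparse: "\<And>y. y \<in> X \<Longrightarrow> q * card {w \<in> W. U (\<phi> w y)} \<le> card W"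
    by (rule ex_sparse_cuts[OF asd K amenable m q(1)]) (assumption+, rule that)
  obtain B where B: "finite B" "B \<subseteq> carrier G" "\<And>x. x \<in> X \<Longrightarrow> \<exists>b\<in>B. x = \<phi> b (\<rho> x)"
    "\<And>x. x \<in> X \<Longrightarrow> \<exists>b\<in>B. \<rho> x = \<phi> b x"
    by (rule address_bounded[OF \<rho>]) (rule that)
  let ?W' = "(\<lambda>g. inv g) ` W"
  \<comment> \<open>Contains the displacements from a point to the label of a fine piece reached by
    a move, so at most \<open>d + 1\<close> coarse classes compete for each point.\<close>
  let ?S = "B <#> (W <#> ?W')"
  have W': "finite ?W'" "?W' \<subseteq> carrier G" using W by auto
  have S: "finite ?S" "?S \<subseteq> carrier G" using B W W' by (simp_all add: finite_set_mult set_mult_closed)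
  obtain e where e: "address e" and mult: "\<And>x. x \<in> X \<Longrightarrow> card (e ` act ?S {x}) \<le> d + 1"
    using asd S unfolding asd_le_def by metis
  \<comment> \<open>Evaluating \<open>e\<close> at the label of the fine piece makes
    \<open>\<alpha>\<close> constant on fine pieces, so each of its fibers is a union of
    them.\<close>
  define \<alpha> where "\<alpha> z = e (\<rho> z)" for z
  have \<alpha>: "address \<alpha>" unfolding \<alpha>_def by (rule address_comp[OF e \<rho>])
  let ?J = "W \<times> W"
  \<comment> \<open>Moves are indexed by pairs and counted with multiplicity: they then split into
    \<open>card W\<close> translates of \<open>W\<close>, and swapping the pair inverts the
    move.\<close>
  define g where "g j = snd j \<otimes> inv (fst j)" for j
  have gG: "g j \<in> carrier G" if "j \<in> ?J" for j using that W by (auto simp: g_def intro!: m_closed inv_closed)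
  have g_act: "\<phi> (g (v, w)) x = \<phi> w (\<phi> (inv v) x)" if "v \<in> W" "w \<in> W" "x \<in> X" for v w x
    using that W by (auto simp: g_def intro!: act_mult)
  have J: "finite ?J" "card ?J = card W * card W" "0 < card ?J"
    using W by (auto simp: card_cartesian_product card_gt_0_iff)
  define hits where "hits p u = {j \<in> ?J. \<not> U (\<phi> (g j) u) \<and> \<alpha> (\<phi> (g j) u) = p}" for p u
  \<comment> \<open>A bad point may follow any move to a good point whose coarse class reaches the
    share \<open>1 / (2 * (d + 1))\<close>; this threshold is all that the backward count uses. A
    good point only has the trivial moves.\<close>
  define sel where "sel j u \<longleftrightarrow> (if U u then \<not> U (\<phi> (g j) u) \<and>
     card ?J \<le> 2 * (d + 1) * card (hits (\<alpha> (\<phi> (g j) u)) u) else fst j = snd j)" for j u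
  have ag: "address (\<lambda>u. \<alpha> (\<phi> (g j) u))" if "j \<in> ?J" for j
    by (rule address_comp[OF \<alpha> address_act[OF gG[OF that]]])
  have mg: "meas (\<lambda>u. \<not> U (\<phi> (g j) u))" if "j \<in> ?J" for j
    by (rule meas_not, rule meas_translate[OF gG[OF that] meas_U])
  have meas_sel: "meas (sel j)" if j: "j \<in> ?J" for j
  proof -
    have "simple (\<lambda>u. hits (\<alpha> (\<phi> (g j) u)) u)" unfolding hits_def
      by (rule simple_Collect[OF J(1)], rule meas_conj[OF mg meas_address_eq[OF ag ag[OF j]]])
    then have "meas (\<lambda>u. card ?J \<le> 2 * (d + 1) * card (hits (\<alpha> (\<phi> (g j) u)) u))"
      by (rule meas_comp)
    from meas_conj[OF meas_imp[OF meas_U meas_conj[OF mg[OF j] this]]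
        meas_imp[OF meas_not[OF meas_U] meas_const[of "fst j = snd j"]]]
    show ?thesis by (rule meas_cong) (auto simp: sel_def)
  qed
  \<comment> \<open>For fixed \<open>v\<close> the moves sweep out the translate of \<open>W\<close>
    based at \<open>\<phi> (inv v) u\<close>, to which \<open>sparse\<close> applies.\<close>
  have bad_pairs: "q * card {j \<in> ?J. U (\<phi> (g j) u)} \<le> card ?J" if u: "u \<in> X" for u
  proof -
    have "{j \<in> ?J. U (\<phi> (g j) u)} = (SIGMA v:W. {w \<in> W. U (\<phi> w (\<phi> (inv v) u))})"
      using g_act u by auto
    then have "q * card {j \<in> ?J. U (\<phi> (g j) u)} = (\<Sum>v\<in>W. q * card {w \<in> W. U (\<phi> w (\<phi> (inv v) u))})"
      using W by (simp add: sum_distrib_left)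
    also have "\<dots> \<le> (\<Sum>v\<in>W. card W)"
      by (rule sum_mono, rule sparse) (use W u in auto)
    finally show ?thesis using J by simp
  qed
  have half: "card ?J \<le> 2 * card {j \<in> ?J. \<not> U (\<phi> (g j) u)}" if u: "u \<in> X" for u
  proof -
    have "card ?J = card ({j \<in> ?J. U (\<phi> (g j) u)} \<union> {j \<in> ?J. \<not> U (\<phi> (g j) u)})"
      by (rule arg_cong[of _ _ card]) auto
    also have "\<dots> = card {j \<in> ?J. U (\<phi> (g j) u)} + card {j \<in> ?J. \<not> U (\<phi> (g j) u)}"
      using J(1) by (intro card_Un_disjoint) auto
    finally have "card ?J = card {j \<in> ?J. U (\<phi> (g j) u)} + card {j \<in> ?J. \<not> U (\<phi> (g j) u)}" .
    moreover have "2 * card {j \<in> ?J. U (\<phi> (g j) u)} \<le> card ?J"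
      using bad_pairs[OF u] mult_right_mono[OF q(2), of "card {j \<in> ?J. U (\<phi> (g j) u)}"] by linarith
    ultimately show ?thesis by linarith
  qed
  have lab: "\<alpha> (\<phi> (g j) u) \<in> e ` act ?S {u}" if u: "u \<in> X" and j: "j \<in> ?J" for u j
  proof -
    obtain v w where vw: "j = (v, w)" "v \<in> W" "w \<in> W" using j by auto
    have "\<phi> (g j) u \<in> act W (act ?W' {u})" unfolding vw(1) g_act[OF vw(2,3) u] by (intro actI vw imageI) simp
    moreover obtain b where "b \<in> B" "\<rho> (\<phi> (g j) u) = \<phi> b (\<phi> (g j) u)"
      using B(4)[of "\<phi> (g j) u"] gG[OF j] u by auto
    ultimately have "\<rho> (\<phi> (g j) u) \<in> act B (act W (act ?W' {u}))" by (simp add: actI)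
    then have "\<rho> (\<phi> (g j) u) \<in> act ?S {u}"
      using u B W W' by (simp add: act_act act_subset set_mult_closed)
    then show ?thesis by (simp add: \<alpha>_def)
  qed
  have sel_ex: "\<exists>j\<in>?J. sel j u" if u: "u \<in> X" for u
  proof (cases "U u")
    case False
    obtain w where "w \<in> W" using W by auto
    then show ?thesis using False by (intro bexI[of _ "(w, w)"]) (auto simp: sel_def)
  next
    case True
    let ?L = "e ` act ?S {u}" and ?N = "{j \<in> ?J. \<not> U (\<phi> (g j) u)}"
    have L: "finite ?L" "card ?L \<le> d + 1" using S mult[OF u] by (auto simp: finite_act)
    have "?N \<noteq> {}" using half[OF u] J(3) by (metis card.empty mult_0_right not_le)
    then have "?L \<noteq> {}" using lab[OF u] by blast
    \<comment> \<open>Pigeonhole: at least half of the moves end at good points, and these lie in at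
      most \<open>d + 1\<close> coarse classes.\<close>
    have "\<exists>p\<in>?L. card ?J \<le> 2 * (d + 1) * card (hits p u)"
    proof (rule ccontr)
      assume "\<not> ?thesis"
      then have lt: "2 * (d + 1) * card (hits p u) < card ?J" if "p \<in> ?L" for p using that by auto
      have "(\<Sum>p\<in>?L. \<Sum>j\<in>{j \<in> ?N. \<alpha> (\<phi> (g j) u) = p}. 1::nat) = (\<Sum>j\<in>?N. 1)"
        by (rule sum.group) (use L J(1) lab[OF u] in auto)
      moreover have "hits p u = {j \<in> ?N. \<alpha> (\<phi> (g j) u) = p}" for p by (auto simp: hits_def)
      ultimately have "(\<Sum>p\<in>?L. card (hits p u)) = card ?N" by simp
      then have "2 * (d + 1) * card ?N = (\<Sum>p\<in>?L. 2 * (d + 1) * card (hits p u))"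
        by (simp only: sum_distrib_left[symmetric])
      also have "\<dots> < (\<Sum>p\<in>?L. card ?J)"
        by (rule sum_strict_mono) (use L \<open>?L \<noteq> {}\<close> lt in auto)
      also have "\<dots> \<le> (d + 1) * card ?J" using L by (simp only: sum_constant of_nat_id mult_right_mono)
      also have "\<dots> \<le> (d + 1) * (2 * card ?N)" by (rule mult_left_mono[OF half[OF u]]) simp
      finally show False by simp
    qed
    then obtain p where p: "card ?J \<le> 2 * (d + 1) * card (hits p u)" by auto
    have "hits p u \<noteq> {}" using p J(3) by (metis card.empty mult_0_right not_le)
    then obtain j where "j \<in> hits p u" by auto
    then have "j \<in> ?J" "sel j u" using p True by (auto simp: hits_def sel_def)
    then show ?thesis by blast
  qed
  obtain \<Psi> where \<Psi>: "address \<Psi>" "\<And>u. u \<in> X \<Longrightarrow> \<exists>j\<in>?J. sel j u \<and> \<Psi> u = \<alpha> (\<phi> (g j) u)"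
    by (rule address_select[OF J(1), of "\<lambda>j u. \<alpha> (\<phi> (g j) u)" sel, OF ag meas_sel sel_ex])
      (assumption+, rule that)
  have \<Psi>_good: "\<Psi> x = \<alpha> x" if x: "x \<in> X" "\<not> U x" for x
  proof -
    obtain j where j: "j \<in> ?J" "sel j x" "\<Psi> x = \<alpha> (\<phi> (g j) x)" using \<Psi>(2)[OF x(1)] by auto
    then obtain w where w: "j = (w, w)" "w \<in> W" using x by (auto simp: sel_def)
    then have "\<phi> (g j) x = x" using g_act[of w w x] x W by auto
    then show ?thesis using j by simp
  qed
  have \<Psi>_bad: "card ?J \<le> 2 * (d + 1) * card (hits (\<Psi> u) u)" if u: "u \<in> X" "U u" for u
    using \<Psi>(2)[OF u(1)] u(2) by (auto simp: sel_def)
  show ?thesis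
  proof (rule that[OF \<Psi>(1)])
    fix p
    let ?\<Phi> = "fiber \<Psi> p"
    define R where "R = {u \<in> ?\<Phi>. U u}"
    define C where "C = {x \<in> ?\<Phi>. \<not> U x}"
    have fin: "finite ?\<Phi>" "finite R" "finite C" using \<Psi>(1) by (simp_all add: R_def C_def)
    have C_iff: "x \<in> C \<longleftrightarrow> x \<in> X \<and> \<not> U x \<and> \<alpha> x = p" for x
      using \<Psi>_good by (auto simp: C_def mem_fiber)
    have R_iff: "x \<in> R \<longleftrightarrow> x \<in> X \<and> U x \<and> \<Psi> x = p" for x
      by (auto simp: R_def mem_fiber)
    \<comment> \<open>\<open>?M\<close> lists moves from absorbed points into the good part of the
      class, \<open>?M'\<close> the reversed moves from that good part to arbitrary bad points.
      Start and pair are recovered from endpoint and pair, and by \<open>sparse\<close> at most a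
      fraction \<open>1 / q\<close> of the reversed moves end at bad points.\<close>
    let ?M = "SIGMA u:R. hits p u"
    let ?M' = "SIGMA z:C. SIGMA w:W. {v \<in> W. U (\<phi> v (\<phi> (inv w) z))}"
    have "card ?M \<le> card ?M'"
    proof (rule card_inj_on_le)
      let ?f = "\<lambda>(u, j). (\<phi> (g j) u, snd j, fst j)"
      have undo: "\<phi> v (\<phi> (inv w) (\<phi> (g (v, w)) u)) = u" "\<phi> (g (v, w)) u \<in> X"
        if "u \<in> X" "v \<in> W" "w \<in> W" for u v w
        using that W by (auto simp: g_act subset_iff)
      show "inj_on ?f ?M"
      proof (rule inj_onI)
        fix a b assume ab: "a \<in> ?M" "b \<in> ?M" "?f a = ?f b"
        obtain u v w where a: "a = (u, v, w)" by (cases a) auto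
        obtain u' v' w' where b: "b = (u', v', w')" by (cases b) auto
        have "u \<in> X" "u' \<in> X" "v \<in> W" "w \<in> W" using ab a b by (auto simp: R_iff hits_def)
        moreover have "v = v'" "w = w'" "\<phi> (g (v, w)) u = \<phi> (g (v', w')) u'" using ab a b by auto
        ultimately have "u = u'" using undo(1)[of u v w] undo(1)[of u' v w] by simp
        then show "a = b" using a b \<open>v = v'\<close> \<open>w = w'\<close> by simp
      qed
      show "?f ` ?M \<subseteq> ?M'"
      proof
        fix y assume "y \<in> ?f ` ?M"
        then obtain u v w where u: "u \<in> R" "(v, w) \<in> hits p u" "y = (\<phi> (g (v, w)) u, w, v)" by auto
        then have "u \<in> X" "U u" "v \<in> W" "w \<in> W" by (auto simp: R_iff hits_def)
        then show "y \<in> ?M'" using u undo[of u v w] by (auto simp: C_iff hits_def)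
      qed
      show "finite ?M'" using fin W by auto
    qed
    moreover have "q * card ?M' \<le> card C * card ?J"
    proof -
      have "q * card ?M' = (\<Sum>z\<in>C. \<Sum>w\<in>W. q * card {v \<in> W. U (\<phi> v (\<phi> (inv w) z))})"
        using fin W by (simp add: sum_distrib_left)
      also have "\<dots> \<le> (\<Sum>z\<in>C. \<Sum>w\<in>W. card W)"
        by (intro sum_mono sparse) (use W C_iff in auto)
      finally show ?thesis using J by simp
    qed
    moreover have "card R * card ?J \<le> 2 * (d + 1) * card ?M"
    proof -
      have "card R * card ?J = (\<Sum>u\<in>R. card ?J)" by simp
      also have "\<dots> \<le> (\<Sum>u\<in>R. 2 * (d + 1) * card (hits p u))"
        by (rule sum_mono) (use \<Psi>_bad R_iff in auto)
      also have "\<dots> = 2 * (d + 1) * card ?M"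
        using fin J(1) by (simp add: sum_distrib_left hits_def)
      finally show ?thesis .
    qed
    ultimately have "q * (card R * card ?J) \<le> 2 * (d + 1) * (card C * card ?J)"
    proof -
      assume a: "card ?M \<le> card ?M'" "q * card ?M' \<le> card C * card ?J"
        "card R * card ?J \<le> 2 * (d + 1) * card ?M"
      have "q * (card R * card ?J) \<le> q * (2 * (d + 1) * card ?M)" by (rule mult_left_mono[OF a(3)]) simp
      also have "\<dots> = 2 * (d + 1) * (q * card ?M)" by (simp only: ac_simps)
      also have "\<dots> \<le> 2 * (d + 1) * (q * card ?M')" using a(1) by (intro mult_left_mono) auto
      also have "\<dots> \<le> 2 * (d + 1) * (card C * card ?J)" by (rule mult_left_mono[OF a(2)]) simp
      finally show ?thesis .
    qed
    then have "2 * (d + 1) * card ?J * (m * card R) \<le> 2 * (d + 1) * card ?J * card C"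
      unfolding q_def by (simp only: ac_simps)
    then have mR: "m * card R \<le> card C" using J(3) by (simp only: mult_le_cancel1) auto
    let ?cut = "\<lambda>x. \<exists>k\<in>K. \<rho> (\<phi> k x) \<noteq> \<rho> x"
    \<comment> \<open>A good fine piece that meets \<open>C\<close> is contained in
      \<open>C\<close>, so the bounds for single pieces add up.\<close>
    have mC: "m * card {x \<in> C. ?cut x} \<le> 1 * card C"
    proof (rule card_le_by_fibers[where f = \<rho>])
      fix p'
      show "m * card {x \<in> {x \<in> C. ?cut x}. \<rho> x = p'} \<le> 1 * card {x \<in> C. \<rho> x = p'}"
      proof (cases "{x \<in> {x \<in> C. ?cut x}. \<rho> x = p'} = {}")
        case False
        then obtain x where x: "x \<in> C" "\<rho> x = p'" by blast
        have eq: "{x \<in> C. \<rho> x = p'} = fiber \<rho> p'"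
        proof (intro equalityI subsetI)
          fix y assume "y \<in> fiber \<rho> p'"
          then have y: "y \<in> X" "\<rho> y = \<rho> x" using x by (auto simp: mem_fiber)
          moreover have "x \<in> X" "\<not> U x" "e (\<rho> x) = p" using x by (auto simp: C_iff \<alpha>_def)
          ultimately have "y \<in> C" using U_sat[of y x] by (simp add: C_iff \<alpha>_def)
          then show "y \<in> {x \<in> C. \<rho> x = p'}" using x y by simp
        qed (auto simp: C_iff mem_fiber)
        have "{x \<in> {x \<in> C. ?cut x}. \<rho> x = p'} = {y \<in> fiber \<rho> p'. ?cut y}"
          unfolding eq[symmetric] by blast
        then show ?thesis using good_cut[of x] x eq by (auto simp: C_iff)
      qed (simp only: card.empty)
    qed (use fin in auto)
    \<comment> \<open>A good point that is not a cut point keeps its fine piece under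
      \<open>K\<close>, hence its class. Only absorbed points and cut points can leave the
      class.\<close>
    have "act K ?\<Phi> - ?\<Phi> \<subseteq> act K (R \<union> {x \<in> C. ?cut x})"
    proof
      fix y assume y: "y \<in> act K ?\<Phi> - ?\<Phi>"
      then obtain k x where k: "k \<in> K" "x \<in> ?\<Phi>" "y = \<phi> k x" by (auto simp: act_def)
      then have x: "x \<in> X" "k \<in> carrier G" using K by (auto simp: mem_fiber)
      have "x \<in> R \<union> {x \<in> C. ?cut x}"
      proof (rule ccontr)
        assume "x \<notin> R \<union> {x \<in> C. ?cut x}"
        then have xC: "x \<in> C" "\<rho> y = \<rho> x" using k by (auto simp: R_def C_def)
        then have "y \<in> C" using x k U_sat[of y x] by (auto simp: C_iff \<alpha>_def)
        then show False using y by (simp add: C_def)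
      qed
      then show "y \<in> act K (R \<union> {x \<in> C. ?cut x})" using k by (auto intro: actI)
    qed
    then have "card (act K ?\<Phi> - ?\<Phi>) \<le> card (act K (R \<union> {x \<in> C. ?cut x}))"
      by (rule card_mono[rotated]) (use fin K in \<open>simp add: finite_act\<close>)
    also have "\<dots> \<le> card K * card (R \<union> {x \<in> C. ?cut x})" by (rule card_act_le) (use fin K in auto)
    also have "\<dots> \<le> card K * (card R + card {x \<in> C. ?cut x})" by (intro mult_left_mono card_Un_le) simp
    finally have "m * card (act K ?\<Phi> - ?\<Phi>) \<le> m * (card K * (card R + card {x \<in> C. ?cut x}))"
      by (rule mult_left_mono) simp
    also have "\<dots> = card K * (m * card R + m * card {x \<in> C. ?cut x})" by (simp add: algebra_simps)
    also have "\<dots> \<le> card K * (2 * card C)" using mR mC by (intro mult_left_mono) auto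
    also have "\<dots> \<le> card K * (2 * card ?\<Phi>)"
      using fin by (intro mult_left_mono card_mono) (auto simp: C_def)
    finally show "m * card (act K ?\<Phi> - ?\<Phi>) \<le> 2 * card K * card ?\<Phi>" by (simp add: ac_simps)
  qed
qed

end

section \<open>Invariance of the shapes and amenability of subgroups\<close>

text \<open>A single translate \<open>?kF\<close> has the size of \<open>F\<close>, so
  \<open>F - ?kF\<close> and \<open>?kF - F\<close> are equally large. Enlarging \<open>?kF\<close>
  to \<open>K <#> F\<close> shrinks the first set and enlarges the second.\<close>

lemma (in group) card_Diff_set_mult_le:
  assumes F: "finite F" "F \<subseteq> carrier G" and K: "finite K" "K \<subseteq> carrier G" "K \<noteq> {}"
  shows "card (F - (K <#> F)) \<le> card ((K <#> F) - F)"
proof -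
  obtain k where k: "k \<in> K" using K by auto
  then have kG: "k \<in> carrier G" using K by auto
  let ?kF = "(\<lambda>f. k \<otimes> f) ` F"
  have fin: "finite ?kF" "finite (K <#> F)" using F K by (auto simp: set_mult_def)
  have sub: "?kF \<subseteq> K <#> F" using k by (auto simp: set_mult_def)
  have "card ?kF = card F"
    using F kG by (intro card_image inj_onI) (auto simp: subset_iff)
  then have "card (F - ?kF) = card (?kF - F)"
    using card_Diff_subset_Int[of F ?kF] card_Diff_subset_Int[of ?kF F] F(1) fin
    by (simp add: Int_commute)
  moreover have "card (F - (K <#> F)) \<le> card (F - ?kF)"
    using sub F by (intro card_mono) auto
  moreover have "card (?kF - F) \<le> card ((K <#> F) - F)"
    using sub fin by (intro card_mono) auto
  ultimately show ?thesis by linarith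
qed

lemma (in measured_action) invariant_tiling:
  assumes asd: "asd_le d" and K: "finite K" "K \<subseteq> carrier G" "K \<noteq> {}" and \<delta>: "0 < (\<delta>::real)"
    and amenable: "\<And>Q. \<lbrakk>finite Q; Q \<subseteq> carrier G\<rbrakk> \<Longrightarrow>
      \<exists>W. finite W \<and> W \<noteq> {} \<and> W \<subseteq> carrier G \<and> card (Q <#> W) \<le> 2 * card W"
  obtains n :: nat and F C where "\<And>i. i \<in> {1..n} \<Longrightarrow> invariant_set G K \<delta> (F i)"
    "\<And>i. i \<in> {1..n} \<Longrightarrow> C i \<in> A"
    "bij_betw (\<lambda>(i, f, c). \<phi> f c) (SIGMA i:{1..n}. F i \<times> C i) X"
proof -
  \<comment> \<open>Carving asks for a symmetric set containing the identity. Enlarging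
    \<open>K\<close> only enlarges the outer boundary that is to be bounded.\<close>
  let ?K = "insert \<one> (K \<union> (\<lambda>k. inv k) ` K)"
  have K': "finite ?K" "?K \<subseteq> carrier G" "\<one> \<in> ?K" "\<And>k. k \<in> ?K \<Longrightarrow> inv k \<in> ?K"
    using K by (auto simp: subset_iff)
  \<comment> \<open>One factor 2 comes from \<open>ex_invariant_address\<close>, the other from the
    two halves of the symmetric difference.\<close>
  obtain m :: nat where m: "4 * real (card ?K) / \<delta> < real m" using reals_Archimedean2 by blast
  have "0 \<le> 4 * real (card ?K) / \<delta>" using \<delta> by simp
  then have m0: "0 < m" using m by (cases m) auto
  obtain \<Psi> where \<Psi>: "address \<Psi>"
    "\<And>p. m * card (act ?K (fiber \<Psi> p) - fiber \<Psi> p) \<le> 2 * card ?K * card (fiber \<Psi> p)"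
    by (rule ex_invariant_address[OF asd K' amenable m0]) (assumption+, rule that)
  obtain n :: nat and F C where F: "\<And>i. i \<in> {1..n} \<Longrightarrow> \<exists>p\<in>X. F i = shape \<Psi> p \<and> F i \<noteq> {}"
    and C: "\<And>i. i \<in> {1..n} \<Longrightarrow> C i \<in> A"
      "bij_betw (\<lambda>(i, f, c). \<phi> f c) (SIGMA i:{1..n}. F i \<times> C i) X"
    by (rule tiling_of_address[OF \<Psi>(1)]) (rule that)
  have "invariant_set G K \<delta> (F i)" if i: "i \<in> {1..n}" for i
  proof -
    let ?F = "F i"
    obtain p where p: "p \<in> X" "?F = shape \<Psi> p" "?F \<noteq> {}" using F[OF i] by auto
    have fin: "finite ?F" "?F \<subseteq> carrier G"
      using p finite_shape[OF \<Psi>(1)] shape_carrier by auto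
    have KF: "?K <#> ?F \<subseteq> carrier G" by (rule set_mult_closed[OF K'(2) fin(2)])
    have finKF: "finite (?K <#> ?F)" using K'(1) fin(1) by (rule finite_set_mult)
    have fib: "fiber \<Psi> p = act ?F {p}" using fiber_eq_act_shape[OF \<Psi>(1) p(1)] p(2) by simp
    \<comment> \<open>The orbit map at \<open>p\<close> is injective by freeness, so the boundary of
      the fiber is a copy of the boundary of the shape.\<close>
    have "act ?K (fiber \<Psi> p) - fiber \<Psi> p = act (?K <#> ?F) {p} - act ?F {p}"
      unfolding fib using act_act[OF K'(2) fin(2), of "{p}"] p by simp
    also have "\<dots> = act ((?K <#> ?F) - ?F) {p}"
    proof (intro equalityI subsetI)
      fix y assume "y \<in> act ((?K <#> ?F) - ?F) {p}"
      then obtain h where h: "h \<in> ?K <#> ?F" "h \<notin> ?F" "y = \<phi> h p" by (auto simp: act_def)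
      have "y \<notin> act ?F {p}"
      proof
        assume "y \<in> act ?F {p}"
        then obtain h' where "h' \<in> ?F" "y = \<phi> h' p" by (auto simp: act_def)
        moreover have "h \<in> carrier G" using h KF by auto
        ultimately have "h = h'" using h p fin(2) act_inj[of h h' p] by auto
        then show False using h \<open>h' \<in> ?F\<close> by simp
      qed
      then show "y \<in> act (?K <#> ?F) {p} - act ?F {p}" using h by (auto intro: actI)
    qed (auto simp: act_def)
    finally have "card (act ?K (fiber \<Psi> p) - fiber \<Psi> p) = card ((?K <#> ?F) - ?F)"
      using KF p by (simp add: card_act_point subset_iff)
    moreover have "card (fiber \<Psi> p) = card ?F" using p \<Psi>(1) by (simp add: card_fiber)
    ultimately have le: "m * card ((?K <#> ?F) - ?F) \<le> 2 * card ?K * card ?F"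
      using \<Psi>(2)[of p] by simp
    have "card (sym_diff (K <#> ?F) ?F) \<le> card ((K <#> ?F) - ?F) + card (?F - (K <#> ?F))"
      by (rule card_Un_le)
    also have "\<dots> \<le> 2 * card ((K <#> ?F) - ?F)"
      using card_Diff_set_mult_le[OF fin K] by simp
    also have "\<dots> \<le> 2 * card ((?K <#> ?F) - ?F)"
      by (intro mult_left_mono card_mono) (use finKF in \<open>auto simp: set_mult_def\<close>)
    finally have "m * card (sym_diff (K <#> ?F) ?F) \<le> 4 * card ?K * card ?F"
      using le mult_left_mono[of "card (sym_diff (K <#> ?F) ?F)" "2 * card ((?K <#> ?F) - ?F)" m] by linarith
    then have "real m * card (sym_diff (K <#> ?F) ?F) \<le> 4 * real (card ?K) * card ?F"
      unfolding of_nat_mult[symmetric] of_nat_numeral[symmetric, where 'a = real] of_nat_le_iff by simp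
    also have "\<dots> < \<delta> * real m * card ?F"
      using m \<delta> fin p by (intro mult_strict_right_mono) (auto simp: field_simps card_gt_0_iff)
    finally have "real m * card (sym_diff (K <#> ?F) ?F) < real m * (\<delta> * card ?F)" by (simp add: ac_simps)
    then have "card (sym_diff (K <#> ?F) ?F) < \<delta> * card ?F" using m0 by simp
    then show ?thesis using fin by (simp add: invariant_set_def)
  qed
  then show ?thesis using C by (rule that)
qed

text \<open>A Folner set of the whole group is sliced by the right cosets of the subgroup.\<close>

lemma amenable_subgroup_doubling:
  fixes G (structure)
  assumes am: "amenable_group G" and H: "subgroup H G" and Q: "finite Q" "Q \<subseteq> H"
  shows "\<exists>W. finite W \<and> W \<noteq> {} \<and> W \<subseteq> H \<and> card (Q <#> W) \<le> 2 * card W"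
proof -
  interpret group G using am by (simp add: amenable_group_def)
  interpret subgroup H G by (rule H)
  \<comment> \<open>\<open>Q\<close> may be empty, whereas Folner sets are provided for nonempty
    sets. Invariance with constant 1 yields \<open>card (Q <#> F) < 2 * card F\<close>.\<close>
  let ?Q = "insert \<one> Q"
  have QG: "?Q \<subseteq> carrier G" "finite ?Q" "?Q \<noteq> {}" using Q subset by auto
  then obtain F where "invariant_set G ?Q 1 F"
    using am unfolding amenable_group_def by (metis zero_less_one)
  then have F: "finite F" "F \<subseteq> carrier G" "card (sym_diff (?Q <#> F) F) < card F"
    by (auto simp: invariant_set_def)
  have fin: "finite (Q <#> F)" using Q F by (simp add: set_mult_def)
  have "card (Q <#> F) \<le> card (((Q <#> F) - F) \<union> F)" using fin F by (intro card_mono) auto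
  also have "\<dots> \<le> card ((Q <#> F) - F) + card F" by (rule card_Un_le)
  also have "card ((Q <#> F) - F) \<le> card (sym_diff (?Q <#> F) F)"
  proof (rule card_mono)
    have "finite (?Q <#> F)" using Q F by (simp add: set_mult_def)
    then show "finite (sym_diff (?Q <#> F) F)" using F by simp
  qed (auto simp: set_mult_def)
  finally have lt: "card (Q <#> F) < 2 * card F" using F by linarith
  \<comment> \<open>If on every coset the slice of \<open>Q <#> F\<close> were at least twice that
    of \<open>F\<close>, summation would contradict \<open>lt\<close>.\<close>
  have "\<exists>c. \<not> 2 * card {x \<in> F. H #> x = c} \<le> 1 * card {x \<in> Q <#> F. H #> x = c}"
  proof (rule ccontr)
    assume "\<not> ?thesis"
    then have "2 * card {x \<in> F. H #> x = c} \<le> 1 * card {x \<in> Q <#> F. H #> x = c}" for c by blast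
    then have "2 * card F \<le> 1 * card (Q <#> F)" by (rule card_le_by_fibers[OF F(1) fin])
    then show False using lt by simp
  qed
  then obtain c where "\<not> 2 * card {x \<in> F. H #> x = c} \<le> 1 * card {x \<in> Q <#> F. H #> x = c}"
    by (rule exE)
  then have c: "card {x \<in> Q <#> F. H #> x = c} < 2 * card {x \<in> F. H #> x = c}" by linarith
  let ?F = "{x \<in> F. H #> x = c}"
  have "?F \<noteq> {}" using c by (metis card.empty mult_0_right not_less_zero)
  then obtain g where g: "g \<in> F" "H #> g = c" by auto
  then have gG: "g \<in> carrier G" using F by auto
  \<comment> \<open>Right translation by \<open>inv g\<close> carries the slice into
    \<open>H\<close> and commutes with left multiplication by \<open>Q\<close>, so the ratio
    survives.\<close>
  let ?W = "(\<lambda>x. x \<otimes> inv g) ` ?F"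
  have inj: "inj_on (\<lambda>x. x \<otimes> inv g) (carrier G)" using gG by (intro inj_onI) simp
  have QF: "Q <#> ?F \<subseteq> {x \<in> Q <#> F. H #> x = c}"
  proof
    fix y assume "y \<in> Q <#> ?F"
    then obtain a x where ax: "a \<in> Q" "x \<in> F" "H #> x = c" "y = a \<otimes> x" by (auto simp: set_mult_def)
    have "x \<in> carrier G" "a \<in> H" using ax F Q by auto
    then have "y \<in> H #> x" using ax by (auto simp: r_coset_def)
    then have "H #> y = c" using repr_independence[OF _ \<open>x \<in> carrier G\<close> H] ax by auto
    then show "y \<in> {x \<in> Q <#> F. H #> x = c}" using ax by (auto simp: set_mult_def)
  qed
  have "Q <#> ?W = (\<lambda>x. x \<otimes> inv g) ` (Q <#> ?F)"
  proof -
    have "a \<otimes> (x \<otimes> inv g) = a \<otimes> x \<otimes> inv g" if "a \<in> Q" "x \<in> F" for a x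
    proof -
      have "a \<in> carrier G" "x \<in> carrier G" using that Q F subset by auto
      then show ?thesis using gG by (simp add: m_assoc)
    qed
    then show ?thesis by (auto simp: set_mult_def image_iff)
  qed
  then have "card (Q <#> ?W) \<le> card (Q <#> ?F)"
    using Q F by (simp add: card_image_le set_mult_def)
  also have "\<dots> \<le> card {x \<in> Q <#> F. H #> x = c}" using QF fin by (intro card_mono) auto
  also have "\<dots> \<le> 2 * card ?F" using c by simp
  also have "card ?F = card ?W"
    by (rule card_image[symmetric]) (rule inj_on_subset[OF inj], use F in auto)
  finally have "card (Q <#> ?W) \<le> 2 * card ?W" .
  moreover have "?W \<subseteq> H"
  proof
    fix y assume "y \<in> ?W"
    then obtain x where x: "x \<in> F" "H #> x = H #> g" "y = x \<otimes> inv g" using g by auto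
    then have "x \<in> H #> g" using repr_independenceD[OF H, of x g] F by auto
    then show "y \<in> H" using rcos_module_imp[OF is_group gG] x by simp
  qed
  ultimately show ?thesis using \<open>?F \<noteq> {}\<close> F by (intro exI[of _ ?W]) auto
qed

section \<open>Colorings and representatives of classes\<close>

text \<open>The color of \<open>x\<close> is the least \<open>n\<close> in \<open>I\<close> for
  which \<open>U n\<close> contains \<open>x\<close> but none of its \<open>S\<close>-translates; a
  translate of the same color would lie in that \<open>U n\<close>. \<open>I\<close> is infinite for
  Borel sets and finite for clopen sets, according to the unions that \<open>A\<close>
  admits.\<close>

lemma coloring_of_cover:
  fixes U :: "nat \<Rightarrow> 'x set" and \<phi> :: "'g \<Rightarrow> 'x \<Rightarrow> 'x"
  assumes "algebra X A" and un: "\<And>C. (\<And>n. n \<in> I \<Longrightarrow> C n \<in> A) \<Longrightarrow> (\<Union>n\<in>I. C n) \<in> A"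
    and tr: "\<And>g V. \<lbrakk>g \<in> T; V \<in> A\<rbrakk> \<Longrightarrow> {x \<in> X. \<phi> g x \<in> V} \<in> A"
    and X: "\<And>g x. \<lbrakk>g \<in> T; x \<in> X\<rbrakk> \<Longrightarrow> \<phi> g x \<in> X"
    and U: "\<And>n. n \<in> I \<Longrightarrow> U n \<in> A" and S: "finite S" "S \<subseteq> T"
    and cover: "\<And>x. x \<in> X \<Longrightarrow> \<exists>n\<in>I. x \<in> U n \<and> (\<forall>s\<in>S. \<phi> s x \<notin> U n)"
  shows "\<exists>\<kappa> :: 'x \<Rightarrow> nat. (\<forall>x\<in>X. \<forall>s\<in>S. \<kappa> (\<phi> s x) \<noteq> \<kappa> x) \<and>
    (\<forall>g\<in>T. \<forall>h\<in>T. {x \<in> X. \<kappa> (\<phi> g x) \<le> \<kappa> (\<phi> h x)} \<in> A)"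
proof -
  interpret algebra X A by fact
  define W where "W n = {x \<in> X. x \<in> U n \<and> (\<forall>s\<in>S. \<phi> s x \<notin> U n)}" for n
  define \<kappa> where "\<kappa> x = (LEAST n. n \<in> I \<and> x \<in> W n)" for x
  have \<kappa>: "\<kappa> x \<in> I" "x \<in> W (\<kappa> x)" if x: "x \<in> X" for x
  proof -
    obtain n where "n \<in> I \<and> x \<in> W n" using cover[OF x] x by (auto simp: W_def)
    from LeastI[of "\<lambda>n. n \<in> I \<and> x \<in> W n", OF this] show "\<kappa> x \<in> I" "x \<in> W (\<kappa> x)"
      unfolding \<kappa>_def by auto
  qed
  have \<kappa>_le: "\<kappa> x \<le> n" if "n \<in> I" "x \<in> W n" for n x
    unfolding \<kappa>_def by (rule Least_le) (use that in simp)
  have W: "W n \<in> A" if n: "n \<in> I" for n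
  proof -
    have "(\<Union>s\<in>S. {x \<in> X. \<phi> s x \<in> U n}) \<in> A"
      by (rule finite_UN[OF S(1)]) (rule tr, use S n U in auto)
    then have "U n - (\<Union>s\<in>S. {x \<in> X. \<phi> s x \<in> U n}) \<in> A" using U[OF n] by auto
    moreover have "U n - (\<Union>s\<in>S. {x \<in> X. \<phi> s x \<in> U n}) = W n"
      using sets_into_space[OF U[OF n]] by (auto simp: W_def)
    ultimately show ?thesis by simp
  qed
  define L where "L n = {x \<in> X. \<kappa> x = n}" for n
  have L: "L n \<in> A" if n: "n \<in> I" for n
  proof -
    have "(\<Union>k\<in>I \<inter> {..<n}. W k) \<in> A" by (rule finite_UN) (auto intro: W)
    then have "W n - (\<Union>k\<in>I \<inter> {..<n}. W k) \<in> A" using W[OF n] by auto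
    moreover have "W n - (\<Union>k\<in>I \<inter> {..<n}. W k) = L n"
    proof (intro equalityI subsetI)
      fix x assume x: "x \<in> W n - (\<Union>k\<in>I \<inter> {..<n}. W k)"
      then have "x \<in> X" by (auto simp: W_def)
      moreover have "\<kappa> x \<le> n" using \<kappa>_le n x by auto
      moreover have "\<not> \<kappa> x < n" using \<kappa>[OF \<open>x \<in> X\<close>] x by auto
      ultimately show "x \<in> L n" by (simp add: L_def)
    next
      fix x assume "x \<in> L n"
      then have x: "x \<in> X" "\<kappa> x = n" by (auto simp: L_def)
      then show "x \<in> W n - (\<Union>k\<in>I \<inter> {..<n}. W k)"
        using \<kappa>[OF x(1)] \<kappa>_le[of _ x] by (auto simp: not_less[symmetric])
    qed
    ultimately show ?thesis by simp
  qed
  have "\<kappa> (\<phi> s x) \<noteq> \<kappa> x" if "x \<in> X" "s \<in> S" for x s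
  proof
    assume "\<kappa> (\<phi> s x) = \<kappa> x"
    moreover have "\<phi> s x \<in> X" using X S that by auto
    ultimately show False using \<kappa>(2)[OF that(1)] \<kappa>(2)[of "\<phi> s x"] that(2) by (auto simp: W_def)
  qed
  moreover have "{x \<in> X. \<kappa> (\<phi> g x) \<le> \<kappa> (\<phi> h x)} \<in> A" if g: "g \<in> T" and h: "h \<in> T" for g h
  proof -
    \<comment> \<open>Here \<open>n\<close> is the color of \<open>\<phi> h x\<close>. The smaller
      colors form a finite set, so \<open>un\<close> serves only for the outer union.\<close>
    have "(\<Union>n\<in>I. {x \<in> X. \<phi> h x \<in> L n} \<inter> (\<Union>k\<in>I \<inter> {..n}. {x \<in> X. \<phi> g x \<in> L k})) \<in> A"
      by (rule un, rule Int, rule tr[OF h L], assumption, rule finite_UN) (auto intro: tr g L)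
    moreover have "(\<Union>n\<in>I. {x \<in> X. \<phi> h x \<in> L n} \<inter> (\<Union>k\<in>I \<inter> {..n}. {x \<in> X. \<phi> g x \<in> L k})) =
        {x \<in> X. \<kappa> (\<phi> g x) \<le> \<kappa> (\<phi> h x)}"
      using \<kappa>(1) X g h by (auto simp: L_def)
    ultimately show ?thesis by simp
  qed
  ultimately show ?thesis by blast
qed

lemma card_image_le_of_factor:
  assumes "finite Y" "\<And>y z. \<lbrakk>y \<in> Y; z \<in> Y; g y = g z\<rbrakk> \<Longrightarrow> f y = f z"
  shows "card (f ` Y) \<le> card (g ` Y)"
proof -
  have "f ` Y \<subseteq> (\<lambda>v. f (inv_into Y g v)) ` g ` Y"
  proof
    fix u assume "u \<in> f ` Y"
    then obtain y where y: "y \<in> Y" "u = f y" by auto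
    have "inv_into Y g (g y) \<in> Y" "g (inv_into Y g (g y)) = g y"
      using y by (auto intro: inv_into_into f_inv_into_f)
    then have "u = f (inv_into Y g (g y))" using assms(2)[of y "inv_into Y g (g y)"] y by simp
    then show "u \<in> (\<lambda>v. f (inv_into Y g v)) ` g ` Y" using y by blast
  qed
  then have "card (f ` Y) \<le> card ((\<lambda>v. f (inv_into Y g v)) ` g ` Y)"
    using assms(1) by (intro card_mono) auto
  also have "\<dots> \<le> card (g ` Y)" using assms(1) by (intro card_image_le) simp
  finally show ?thesis .
qed

context measured_action
begin

text \<open>The representative of a class is its point of least color. The class lies in
  \<open>act B {x}\<close> for each of its points \<open>x\<close>, and colors are distinct there,
  so the representative does not depend on \<open>x\<close>.\<close>

lemma address_of_equiv:
  assumes E: "equiv X E" and B: "finite B" "B \<subseteq> carrier G"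
    and bdd: "\<And>x y. (x, y) \<in> E \<Longrightarrow> \<exists>b\<in>B. y = \<phi> b x"
    and meas_E: "\<And>g. g \<in> carrier G \<Longrightarrow> meas (\<lambda>x. (x, \<phi> g x) \<in> E)"
  obtains \<rho> where "address \<rho>" "\<And>x y. (x, y) \<in> E \<Longrightarrow> \<rho> x = \<rho> y"
proof -
  have EX: "x \<in> X" "y \<in> X" if "(x, y) \<in> E" for x y
    using that E by (auto simp: equiv_def refl_on_def)
  have sym: "(y, x) \<in> E" if "(x, y) \<in> E" for x y using that E by (meson equiv_def symD)
  have trans: "(x, z) \<in> E" if "(x, y) \<in> E" "(y, z) \<in> E" for x y z using that E by (meson equiv_def transD)
  have refl: "(x, x) \<in> E" if "x \<in> X" for x using that E by (simp add: equiv_def refl_on_def)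
  obtain \<kappa> :: "'x \<Rightarrow> nat" where \<kappa>: "\<And>x. x \<in> X \<Longrightarrow> inj_on \<kappa> (act B {x})"
    "\<And>f g. \<lbrakk>address f; address g\<rbrakk> \<Longrightarrow> meas (\<lambda>x. \<kappa> (f x) \<le> \<kappa> (g x))"
    by (rule coloring_inj[OF B]) (rule that)
  define P where "P b x \<longleftrightarrow> (x, \<phi> b x) \<in> E \<and> (\<forall>c\<in>B. (x, \<phi> c x) \<in> E \<longrightarrow> \<kappa> (\<phi> b x) \<le> \<kappa> (\<phi> c x))" for b x
  have BG: "b \<in> carrier G" if "b \<in> B" for b using that B by auto
  have meas_P: "meas (P b)" if "b \<in> B" for b
    unfolding P_def
    by (rule meas_conj[OF meas_E[OF BG[OF that]] meas_ball[OF B(1) meas_imp[OF meas_E[OF BG]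
          \<kappa>(2)[OF address_act[OF BG[OF that]] address_act[OF BG]]]]])
  have ex: "\<exists>b\<in>B. P b x" if x: "x \<in> X" for x
  proof -
    let ?T = "{b \<in> B. (x, \<phi> b x) \<in> E}"
    obtain b where "b \<in> B" "x = \<phi> b x" using bdd[OF refl[OF x]] by auto
    then have "b \<in> ?T" using refl[OF x] by auto
    then have "?T \<noteq> {}" "finite ?T" using B by auto
    then obtain b where "b \<in> ?T" "\<forall>c\<in>?T. \<kappa> (\<phi> b x) \<le> \<kappa> (\<phi> c x)"
      using ex_min_if_finite[of "(\<lambda>b. \<kappa> (\<phi> b x)) ` ?T"] by (auto simp: not_less)
    then show ?thesis by (auto simp: P_def)
  qed
  obtain \<rho> where \<rho>: "address \<rho>" "\<And>x. x \<in> X \<Longrightarrow> \<exists>b\<in>B. P b x \<and> \<rho> x = \<phi> b x"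
    by (rule address_select[OF B(1), of "\<lambda>b. \<phi> b" P, OF address_act[OF BG] meas_P ex])
      (assumption+, rule that)
  have \<rho>E: "(x, \<rho> x) \<in> E" if "x \<in> X" for x using \<rho>(2)[OF that] by (auto simp: P_def)
  have least: "\<kappa> (\<rho> x) \<le> \<kappa> y" if "(x, y) \<in> E" for x y
    using \<rho>(2)[OF EX(1)[OF that]] bdd[OF that] that by (auto simp: P_def)
  show ?thesis
  proof (rule that[OF \<rho>(1)])
    fix x y assume xy: "(x, y) \<in> E"
    then have X: "x \<in> X" "y \<in> X" using EX by auto
    have xry: "(x, \<rho> y) \<in> E" using trans[OF xy \<rho>E[OF X(2)]] .
    have "(y, \<rho> x) \<in> E" using trans[OF sym[OF xy] \<rho>E[OF X(1)]] .
    then have eq: "\<kappa> (\<rho> x) = \<kappa> (\<rho> y)" using least[OF xry] least by (simp add: order_antisym)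
    have "\<rho> x \<in> act B {x}" "\<rho> y \<in> act B {x}"
      using bdd[OF \<rho>E[OF X(1)]] bdd[OF xry] by (auto simp: act_def)
    then show "\<rho> x = \<rho> y" by (rule inj_onD[OF \<kappa>(1)[OF X(1)] eq])
  qed
qed

text \<open>The address obtained from \<open>E\<close> is constant on classes, so near a point it
  takes at most as many values as there are classes.\<close>

lemma asd_leI:
  assumes "\<And>S. \<lbrakk>finite S; S \<subseteq> carrier G\<rbrakk> \<Longrightarrow> \<exists>E B. equiv X E \<and> finite B \<and> B \<subseteq> carrier G \<and>
    (\<forall>(x, y)\<in>E. \<exists>b\<in>B. y = \<phi> b x) \<and> (\<forall>g\<in>carrier G. meas (\<lambda>x. (x, \<phi> g x) \<in> E)) \<and>
    (\<forall>x\<in>X. card ((\<lambda>y. E `` {y}) ` act S {x}) \<le> d + 1)"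
  shows "asd_le d"
  unfolding asd_le_def
proof (intro allI impI)
  fix S assume S: "finite S \<and> S \<subseteq> carrier G"
  obtain E B where E: "equiv X E" "finite B" "B \<subseteq> carrier G" "\<forall>(x, y)\<in>E. \<exists>b\<in>B. y = \<phi> b x"
    "\<forall>g\<in>carrier G. meas (\<lambda>x. (x, \<phi> g x) \<in> E)" "\<forall>x\<in>X. card ((\<lambda>y. E `` {y}) ` act S {x}) \<le> d + 1"
    using assms[of S] S by (elim conjE exE) blast
  obtain \<rho> where \<rho>: "address \<rho>" "\<And>x y. (x, y) \<in> E \<Longrightarrow> \<rho> x = \<rho> y"
    by (rule address_of_equiv[OF E(1-3)]) (use E(4,5) in auto)
  have "card (\<rho> ` act S {x}) \<le> d + 1" if x: "x \<in> X" for x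
  proof -
    have "card (\<rho> ` act S {x}) \<le> card ((\<lambda>y. E `` {y}) ` act S {x})"
    proof (rule card_image_le_of_factor)
      show "finite (act S {x})" using S by (simp add: finite_act)
      fix y z assume "y \<in> act S {x}" "z \<in> act S {x}" "E `` {y} = E `` {z}"
      moreover have "act S {x} \<subseteq> X" using S x by (simp add: act_subset)
      ultimately have "(y, z) \<in> E" using eq_equiv_class_iff[OF E(1), of y z] by auto
      then show "\<rho> y = \<rho> z" by (rule \<rho>(2))
    qed
    then show ?thesis using E(6) x by force
  qed
  then show "\<exists>\<rho>. address \<rho> \<and> (\<forall>x\<in>X. card (\<rho> ` act S {x}) \<le> d + 1)" using \<rho>(1) by blast
qed

end

section \<open>The Borel setting\<close>

lemma borel_measured_action:
  fixes G (structure)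
  assumes act: "group_action G (space M) \<phi>" and free: "free_action G (space M) \<phi>"
    and meas: "\<And>g. g \<in> carrier G \<Longrightarrow> \<phi> g \<in> M \<rightarrow>\<^sub>M M" and std: "standard_borel_space M"
  shows "measured_action G (space M) \<phi> (sets M)"
proof -
  interpret group_action G "space M" \<phi> by (rule act)
  have tr: "{x \<in> space M. \<phi> g x \<in> V} \<in> sets M" if "g \<in> carrier G" "V \<in> sets M" for g V
  proof -
    have "\<phi> g -` V \<inter> space M = {x \<in> space M. \<phi> g x \<in> V}" by auto
    then show ?thesis using measurable_sets[OF meas[OF that(1)] that(2)] by simp
  qed
  have cl: "\<phi> g x \<in> space M" if "g \<in> carrier G" "x \<in> space M" for g x
    using element_image[OF that] by simp
  obtain T where T: "completely_metrizable_space T" "separable_space T" "topspace T = space M"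
    "sets M = sigma_sets (topspace T) {U. openin T U}"
    using std by (auto simp: standard_borel_space_def)
  obtain Y \<rho> where Y: "Metric_space Y \<rho>" "T = Metric_space.mtopology Y \<rho>"
    using T(1) by (auto simp: completely_metrizable_space_def)
  interpret Y: Metric_space Y \<rho> by (rule Y(1))
  have YM: "Y = space M" using T(3) Y(2) by simp
  obtain C where C: "countable C" "C \<subseteq> Y" "Y.mtopology closure_of C = Y"
    using T(2) unfolding separable_space_def Y(2) by auto
  \<comment> \<open>Balls of radius \<open>1 / (k + 1)\<close> around a countable dense set,
    enumerated by pairs. They separate a point from any finite set of other points.\<close>
  define U where "U n = Y.mball (from_nat_into C (fst (prod_decode n)))
    (inverse (real (Suc (snd (prod_decode n)))))" for n
  have U: "U n \<in> sets M" for n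
    unfolding T(4) U_def Y(2) by (rule sigma_sets.Basic) simp
  show ?thesis
  proof (intro measured_action.intro act measured_action_axioms.intro)
    show "g = \<one>" if "g \<in> carrier G" "x \<in> space M" "\<phi> g x = x" for g x
      using free that by (auto simp: free_action_def)
    show "algebra (space M) (sets M)" by (rule sets.algebra_axioms)
    show "{x \<in> space M. \<phi> g x \<in> V} \<in> sets M" if "g \<in> carrier G" "V \<in> sets M" for g V
      by (rule tr[OF that])
    fix S assume S: "finite S" "S \<subseteq> carrier G - {\<one>}"
    show "\<exists>\<kappa> :: _ \<Rightarrow> nat. (\<forall>x\<in>space M. \<forall>s\<in>S. \<kappa> (\<phi> s x) \<noteq> \<kappa> x) \<and>
        (\<forall>g\<in>carrier G. \<forall>h\<in>carrier G. {x \<in> space M. \<kappa> (\<phi> g x) \<le> \<kappa> (\<phi> h x)} \<in> sets M)"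
    proof (rule coloring_of_cover[where U = U and I = UNIV])
      show "algebra (space M) (sets M)" by (rule sets.algebra_axioms)
      fix x assume x: "x \<in> space M"
      define \<epsilon> where "\<epsilon> = Min (insert 1 ((\<lambda>s. \<rho> x (\<phi> s x)) ` S))"
      have pos: "0 < \<rho> x (\<phi> s x)" if "s \<in> S" for s
      proof -
        have "\<phi> s x \<noteq> x" using free S that x by (auto simp: free_action_def)
        moreover have "\<phi> s x \<in> Y" using cl S that x YM by auto
        ultimately show ?thesis using x YM Y.mdist_pos_eq by auto
      qed
      have \<epsilon>: "0 < \<epsilon>" using S pos by (auto simp: \<epsilon>_def)
      have \<epsilon>_le: "\<epsilon> \<le> \<rho> x (\<phi> s x)" if "s \<in> S" for s
        unfolding \<epsilon>_def by (rule Min_le) (use S that in auto)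
      \<comment> \<open>A ball of radius below \<open>\<epsilon> / 2\<close> containing
        \<open>x\<close> cannot reach points at distance \<open>\<epsilon>\<close> or more from
        \<open>x\<close>.\<close>
      obtain k where k: "inverse (real (Suc k)) < \<epsilon> / 2" using reals_Archimedean[of "\<epsilon> / 2"] \<epsilon> by auto
      have "x \<in> Y.mtopology closure_of C" using x YM C by simp
      then have "\<forall>r>0. \<exists>y\<in>C. y \<in> Y.mball x r"
        unfolding Y.metric_closure_of by blast
      moreover have "0 < inverse (real (Suc k))" by simp
      ultimately obtain c where c: "c \<in> C" "c \<in> Y.mball x (inverse (real (Suc k)))" by blast
      obtain i where i: "from_nat_into C i = c" using from_nat_into_surj[OF C(1) c(1)] by auto
      have U_eq: "U (prod_encode (i, k)) = Y.mball c (inverse (real (Suc k)))" by (simp add: U_def i)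
      have "x \<in> U (prod_encode (i, k))" using c unfolding U_eq by (simp add: Y.commute)
      moreover have "\<phi> s x \<notin> U (prod_encode (i, k))" if s: "s \<in> S" for s
      proof
        assume "\<phi> s x \<in> U (prod_encode (i, k))"
        then have "\<rho> c (\<phi> s x) < inverse (real (Suc k))" "\<phi> s x \<in> Y" "c \<in> Y" by (simp_all add: U_eq)
        moreover have "\<rho> x c < inverse (real (Suc k))" "x \<in> Y" using c by simp_all
        ultimately have "\<rho> x (\<phi> s x) < \<epsilon>" using Y.triangle[of x c "\<phi> s x"] k by linarith
        then show False using \<epsilon>_le[OF s] by simp
      qed
      ultimately show "\<exists>n\<in>UNIV. x \<in> U n \<and> (\<forall>s\<in>S. \<phi> s x \<notin> U n)" by blast
    qed (use tr cl U S in auto)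
  qed
qed

lemma borel_asdim_finiteD:
  assumes "borel_asdim H M \<phi> < \<infinity>"
  obtains \<tau> d where "proper_right_invariant_metric H \<tau>" "borel_asdim_le H M \<phi> \<tau> d"
  using assms that unfolding borel_asdim_def borel_asdim_wrt_def INF_less_iff by blast

lemma borel_asd_le:
  fixes G (structure)
  assumes act: "measured_action G (space M) \<phi> (sets M)"
    and meas: "\<And>g. g \<in> carrier G \<Longrightarrow> \<phi> g \<in> M \<rightarrow>\<^sub>M M"
    and \<tau>: "proper_right_invariant_metric G \<tau>" and d: "borel_asdim_le G M \<phi> \<tau> d"
  shows "measured_action.asd_le G (space M) \<phi> (sets M) d"
proof -
  interpret measured_action G "space M" \<phi> "sets M" by (rule act)
  interpret \<tau>: Metric_space "carrier G" \<tau> using \<tau> by (simp add: proper_right_invariant_metric_def)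
  show ?thesis
  proof (rule asd_leI)
    fix S assume S: "finite S" "S \<subseteq> carrier G"
    \<comment> \<open>The inserted 1 keeps the radius positive, also when \<open>S\<close> is
      empty.\<close>
    define r where "r = Max (insert 1 (\<tau> \<one> ` S))"
    have r: "0 < r" using S by (auto simp: r_def Max_gr_iff)
    have r_ge: "\<tau> \<one> s \<le> r" if "s \<in> S" for s using S that by (auto simp: r_def intro: Max_ge)
    obtain E R where E: "equiv (space M) E" "E \<in> sets (M \<Otimes>\<^sub>M M)"
      and R: "\<forall>(x, y)\<in>E. action_dist G \<phi> \<tau> x y \<le> ereal R"
      and cl: "\<forall>x\<in>space M. let \<C> = {C \<in> space M // E.
           C \<inter> {y \<in> space M. action_dist G \<phi> \<tau> x y \<le> ereal r} \<noteq> {}} in finite \<C> \<and> card \<C> \<le> d + 1"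
      using d r unfolding borel_asdim_le_def by meson
    have EX: "x \<in> space M" "y \<in> space M" if "(x, y) \<in> E" for x y
      using that E(1) by (auto simp: equiv_def refl_on_def)
    let ?B = "\<tau>.mcball \<one> R"
    have B: "finite ?B" using \<tau> by (auto simp: proper_right_invariant_metric_def)
    have bdd: "\<exists>b\<in>?B. y = \<phi> b x" if xy: "(x, y) \<in> E" for x y
    proof -
      have le: "action_dist G \<phi> \<tau> x y \<le> ereal R" using R xy by auto
      let ?H = "{h \<in> carrier G. \<phi> h x = y}"
      have "?H \<noteq> {}"
      proof
        assume "?H = {}"
        then have "action_dist G \<phi> \<tau> x y = \<infinity>"
          unfolding action_dist_def by (simp only: image_empty Inf_empty top_ereal_def)
        then show False using le by simp
      qed
      then obtain h where h: "h \<in> carrier G" "\<phi> h x = y" by blast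
      \<comment> \<open>By freeness one group element carries \<open>x\<close> to \<open>y\<close>,
        so the infimum is its distance from the identity. Hence it lies in a ball, which is finite
        by properness.\<close>
      have "?H = {h}" using h act_inj[OF _ h(1) EX(1)[OF xy]] by auto
      then have "action_dist G \<phi> \<tau> x y = ereal (\<tau> \<one> h)" by (simp add: action_dist_def)
      then have "h \<in> ?B" using le h by simp
      then show ?thesis using h by auto
    qed
    have "{x \<in> space M. (x, \<phi> g x) \<in> E} \<in> sets M" if g: "g \<in> carrier G" for g
    proof -
      have "(\<lambda>x. (x, \<phi> g x)) \<in> M \<rightarrow>\<^sub>M M \<Otimes>\<^sub>M M" using meas[OF g] by (intro measurable_Pair) auto
      from measurable_sets[OF this E(2)] show ?thesis by (simp add: vimage_def Int_def conj_commute)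
    qed
    moreover have "card ((\<lambda>y. E `` {y}) ` act S {x}) \<le> d + 1" if x: "x \<in> space M" for x
    proof -
      let ?\<C> = "{C \<in> space M // E. C \<inter> {y \<in> space M. action_dist G \<phi> \<tau> x y \<le> ereal r} \<noteq> {}}"
      have \<C>: "finite ?\<C>" "card ?\<C> \<le> d + 1" using bspec[OF cl x] by (simp_all add: Let_def)
      have "(\<lambda>y. E `` {y}) ` act S {x} \<subseteq> ?\<C>"
      proof
        fix C assume "C \<in> (\<lambda>y. E `` {y}) ` act S {x}"
        then obtain s where s: "s \<in> S" "C = E `` {\<phi> s x}" by (auto simp: act_def)
        then have sG: "s \<in> carrier G" "\<phi> s x \<in> space M" using S x by auto
        have "action_dist G \<phi> \<tau> x (\<phi> s x) \<le> ereal r"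
          unfolding action_dist_def by (rule INF_lower2[of s]) (use sG r_ge[OF s(1)] in auto)
        moreover have "\<phi> s x \<in> C" using equiv_class_self[OF E(1) sG(2)] s by simp
        ultimately show "C \<in> ?\<C>" using s sG by (auto intro: quotientI)
      qed
      then have "card ((\<lambda>y. E `` {y}) ` act S {x}) \<le> card ?\<C>" using \<C> by (intro card_mono)
      then show ?thesis using \<C> by simp
    qed
    ultimately show "\<exists>E B. equiv (space M) E \<and> finite B \<and> B \<subseteq> carrier G \<and>
        (\<forall>(x, y)\<in>E. \<exists>b\<in>B. y = \<phi> b x) \<and> (\<forall>g\<in>carrier G. meas (\<lambda>x. (x, \<phi> g x) \<in> E)) \<and>
        (\<forall>x\<in>space M. card ((\<lambda>y. E `` {y}) ` act S {x}) \<le> d + 1)"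
      using E(1) B bdd by (intro exI[of _ E] exI[of _ ?B]) (auto simp: meas_def)
  qed
qed

section \<open>The clopen setting\<close>

text \<open>Each point has a clopen neighbourhood that misses its \<open>S\<close>-translates. By
  compactness finitely many of these sets serve all points, so finitely many colors are
  used.\<close>

lemma clopen_measured_action:
  fixes G (structure)
  assumes act: "group_action G (topspace T) \<phi>" and free: "free_action G (topspace T) \<phi>"
    and cont: "\<And>g. g \<in> carrier G \<Longrightarrow> continuous_map T T (\<phi> g)"
    and T: "compact_space T" "zero_dimensional_space T" "Hausdorff_space T"
  shows "measured_action G (topspace T) \<phi> {U. openin T U \<and> closedin T U}"
proof -
  let ?A = "{U. openin T U \<and> closedin T U}"
  interpret group_action G "topspace T" \<phi> by (rule act)
  have cl: "\<phi> g x \<in> topspace T" if "g \<in> carrier G" "x \<in> topspace T" for g x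
    using element_image[OF that] by simp
  have alg: "algebra (topspace T) ?A"
    unfolding algebra_iff_Un by (auto dest: openin_subset)
  then interpret A: algebra "topspace T" ?A .
  have tr: "{x \<in> topspace T. \<phi> g x \<in> V} \<in> ?A" if "g \<in> carrier G" "V \<in> ?A" for g V
    using that openin_continuous_map_preimage[OF cont] closedin_continuous_map_preimage[OF cont] by auto
  show ?thesis
  proof (intro measured_action.intro act measured_action_axioms.intro alg tr)
    show "g = \<one>" if "g \<in> carrier G" "x \<in> topspace T" "\<phi> g x = x" for g x
      using free that by (auto simp: free_action_def)
    fix S assume S: "finite S" "S \<subseteq> carrier G - {\<one>}"
    define W where "W V = {x \<in> topspace T. x \<in> V \<and> (\<forall>s\<in>S. \<phi> s x \<notin> V)}" for V
    have W: "openin T (W V)" if V: "V \<in> ?A" for V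
    proof -
      have "(\<Union>s\<in>S. {x \<in> topspace T. \<phi> s x \<in> V}) \<in> ?A"
        by (rule A.finite_UN[OF S(1)]) (rule tr[OF _ V], use S in auto)
      then have "V - (\<Union>s\<in>S. {x \<in> topspace T. \<phi> s x \<in> V}) \<in> ?A" by (rule A.Diff[OF V])
      moreover have "V - (\<Union>s\<in>S. {x \<in> topspace T. \<phi> s x \<in> V}) = W V"
        using A.sets_into_space[OF V] by (auto simp: W_def)
      ultimately show ?thesis by simp
    qed
    have cover: "topspace T \<subseteq> \<Union>(W ` ?A)"
    proof
      fix x assume x: "x \<in> topspace T"
      let ?O = "topspace T - (\<lambda>s. \<phi> s x) ` S"
      have "(\<lambda>s. \<phi> s x) ` S \<subseteq> topspace T" using S x cl by auto
      then have "closedin T ((\<lambda>s. \<phi> s x) ` S)"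
        using S Hausdorff_imp_t1_space[OF T(3)] by (simp add: t1_space_closedin_finite)
      then have "openin T ?O" by (simp add: openin_diff)
      moreover have "x \<in> ?O" using free S x by (force simp: free_action_def)
      ultimately obtain V where V: "V \<in> ?A" "x \<in> V" "V \<subseteq> ?O"
        using T(2) unfolding zero_dimensional_space_def by (metis (no_types, lifting) mem_Collect_eq)
      then have "x \<in> W V" using x by (auto simp: W_def)
      then show "x \<in> \<Union>(W ` ?A)" using V by blast
    qed
    have op: "openin T O'" if "O' \<in> W ` ?A" for O' using W that by (elim imageE) simp
    obtain \<F> where \<F>: "finite \<F>" "\<F> \<subseteq> W ` ?A" "topspace T \<subseteq> \<Union>\<F>"
      by (rule exE[OF compactinD[OF T(1)[unfolded compact_space_def] op cover]]) (assumption, elim conjE, rule that)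
    then obtain \<V> where \<V>: "\<V> \<subseteq> ?A" "finite \<V>" "\<F> = W ` \<V>"
      by (meson finite_subset_image)
    obtain xs where xs: "set xs = \<V>" using finite_list[OF \<V>(2)] by auto
    show "\<exists>\<kappa> :: _ \<Rightarrow> nat. (\<forall>x\<in>topspace T. \<forall>s\<in>S. \<kappa> (\<phi> s x) \<noteq> \<kappa> x) \<and>
        (\<forall>g\<in>carrier G. \<forall>h\<in>carrier G. {x \<in> topspace T. \<kappa> (\<phi> g x) \<le> \<kappa> (\<phi> h x)} \<in> ?A)"
    proof (rule coloring_of_cover[OF alg, where U = "\<lambda>n. xs ! n" and I = "{..<length xs}"])
      show "(\<Union>n<length xs. C n) \<in> ?A" if "\<And>n. n \<in> {..<length xs} \<Longrightarrow> C n \<in> ?A" for C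
        by (rule A.finite_UN) (use that in auto)
      show "xs ! n \<in> ?A" if "n \<in> {..<length xs}" for n
        using that xs \<V>(1) nth_mem[of n xs] by auto
      fix x assume x: "x \<in> topspace T"
      then obtain V where "V \<in> \<V>" "x \<in> W V" using \<F>(3) \<V>(3) by auto
      then obtain n where "n < length xs" "xs ! n = V" using xs by (auto simp: in_set_conv_nth)
      then show "\<exists>n\<in>{..<length xs}. x \<in> xs ! n \<and> (\<forall>s\<in>S. \<phi> s x \<notin> xs ! n)"
        using \<open>x \<in> W V\<close> by (auto simp: W_def)
    qed (use tr cl S in auto)
  qed
qed

lemma (in group) word_prod_closed:
  "(\<And>k. k \<in> {1..m} \<Longrightarrow> b k \<in> carrier G) \<Longrightarrow> word_prod G b m \<in> carrier G"
  by (induction m) auto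

lemma word_prod_cong:
  "(\<And>k. k \<in> {1..m} \<Longrightarrow> b k = c k) \<Longrightarrow> word_prod G b m = word_prod G c m"
  by (induction m) auto

text \<open>The open cover is refined to a clopen partition with index \<open>idx\<close>. The
  classes are the components of the graph joining points of equal index that differ by an element of
  \<open>B\<close>. Finite return sets bound the components; as \<open>B\<close> consists of the
  quotients of \<open>S\<close>, points of \<open>act S {x}\<close> with equal index are adjacent,
  so at most \<open>d + 1\<close> classes occur.\<close>

lemma clopen_asd_le:
  fixes G (structure)
  assumes act: "measured_action G (topspace T) \<phi> {U. openin T U \<and> closedin T U}"
    and T: "compact_space T" "zero_dimensional_space T" and d: "dyn_asdim_le G T \<phi> d"
  shows "measured_action.asd_le G (topspace T) \<phi> {U. openin T U \<and> closedin T U} d"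
proof -
  let ?A = "{U. openin T U \<and> closedin T U}" and ?X = "topspace T"
  interpret measured_action G ?X \<phi> ?A by (rule act)
  interpret A: algebra ?X ?A by (rule algebra_A)
  show ?thesis
  proof (rule asd_leI)
    fix S assume S: "finite S" "S \<subseteq> carrier G"
    define B where "B = (\<lambda>(s, t). s \<otimes> inv t) ` (S \<times> S)"
    have B: "finite B" "B \<subseteq> carrier G" using S by (auto simp: B_def subset_iff)
    obtain U where U: "\<forall>i\<le>d. openin T (U i)" "?X \<subseteq> (\<Union>i\<le>d. U i)"
      "\<forall>i\<le>d. finite (return_set G \<phi> B (U i))"
    proof -
      have "compactin T ?X \<and> finite B \<and> B \<subseteq> carrier G" using T(1) B by (simp add: compact_space_def)
      from d[unfolded dyn_asdim_le_def, rule_format, OF this] show ?thesis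
        by (elim exE conjE) (rule that)
    qed
    let ?\<C> = "{V \<in> ?A. \<exists>i\<le>d. V \<subseteq> U i}"
    have cover: "?X \<subseteq> \<Union>?\<C>"
    proof
      fix x assume "x \<in> ?X"
      then obtain i where i: "i \<le> d" "x \<in> U i" using U(2) by auto
      then obtain V where "V \<in> ?A" "x \<in> V" "V \<subseteq> U i"
        using T(2) U(1) unfolding zero_dimensional_space_def by (metis (no_types, lifting) mem_Collect_eq)
      then show "x \<in> \<Union>?\<C>" using i by blast
    qed
    obtain \<F> where \<F>: "finite \<F>" "\<F> \<subseteq> ?\<C>" "?X \<subseteq> \<Union>\<F>"
      by (rule exE[OF compactinD[OF T(1)[unfolded compact_space_def] _ cover]])
        (simp, elim conjE, rule that)
    define P where "P i = \<Union>{V \<in> \<F>. V \<subseteq> U i}" for i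
    have PA: "P i \<in> ?A" for i
      unfolding P_def by (rule A.finite_Union) (use \<F> in auto)
    have PU: "P i \<subseteq> U i" for i by (auto simp: P_def)
    define idx where "idx x = (LEAST i. x \<in> P i)" for x
    have idx: "idx x \<le> d" "x \<in> P (idx x)" if x: "x \<in> ?X" for x
    proof -
      obtain V where V: "V \<in> \<F>" "x \<in> V" using \<F>(3) x by auto
      then obtain i where i: "i \<le> d" "V \<subseteq> U i" using \<F>(2) by auto
      then have xP: "x \<in> P i" using V by (auto simp: P_def)
      show "x \<in> P (idx x)" unfolding idx_def by (rule LeastI[of "\<lambda>i. x \<in> P i" i, OF xP])
      have "idx x \<le> i" unfolding idx_def by (rule Least_le[of "\<lambda>i. x \<in> P i" i, OF xP])
      then show "idx x \<le> d" using i by simp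
    qed
    have meas_P: "meas (\<lambda>x. x \<in> P i)" for i
    proof -
      have "{x \<in> ?X. x \<in> P i} = P i" using A.sets_into_space[OF PA[of i]] by auto
      then show ?thesis using PA[of i] by (simp add: meas_def)
    qed
    have simple_idx: "simple idx"
    proof (rule simpleI[of "{..d}"])
      fix i
      have "meas (\<lambda>x. x \<in> P i \<and> (\<forall>k\<in>{..<i}. \<not> x \<in> P k))"
        by (rule meas_conj[OF meas_P meas_ball[OF finite_lessThan meas_not[OF meas_P]]])
      then show "meas (\<lambda>x. idx x = i)"
      proof (rule meas_cong)
        fix x assume x: "x \<in> ?X"
        show "x \<in> P i \<and> (\<forall>k\<in>{..<i}. \<not> x \<in> P k) \<longleftrightarrow> idx x = i"
        proof
          assume a: "x \<in> P i \<and> (\<forall>k\<in>{..<i}. \<not> x \<in> P k)"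
          have "idx x \<le> i" unfolding idx_def by (rule Least_le) (use a in simp)
          moreover have "\<not> idx x < i" using a idx(2)[OF x] by auto
          ultimately show "idx x = i" by simp
        next
          assume i: "idx x = i"
          have "x \<notin> P k" if "k < i" for k
            by (rule not_less_Least) (use that i in \<open>simp add: idx_def\<close>)
          then show "x \<in> P i \<and> (\<forall>k\<in>{..<i}. \<not> x \<in> P k)" using idx(2)[OF x] i by simp
        qed
      qed
    qed (use idx in auto)
    define r where "r = {(x, y). x \<in> ?X \<and> idx x = idx y \<and> (\<exists>b\<in>B. y = \<phi> b x)}"
    have BI: "\<phi> t x = \<phi> (t \<otimes> inv s) (\<phi> s x)" "t \<otimes> inv s \<in> B" if "s \<in> S" "t \<in> S" "x \<in> ?X" for s t x
    proof -
      have "s \<in> carrier G" "t \<in> carrier G" using S that by auto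
      then show "\<phi> t x = \<phi> (t \<otimes> inv s) (\<phi> s x)" using that by (simp add: act_mult)
      show "t \<otimes> inv s \<in> B" unfolding B_def by (rule image_eqI[of _ _ "(t, s)"]) (use that in auto)
    qed
    have "sym r"
    proof (rule symI)
      fix x y assume "(x, y) \<in> r"
      then obtain s t where st: "x \<in> ?X" "idx x = idx y" "s \<in> S" "t \<in> S" "y = \<phi> (s \<otimes> inv t) x"
        by (auto simp: r_def B_def)
      have G: "s \<in> carrier G" "t \<in> carrier G" using S st by auto
      have "x = \<phi> (t \<otimes> inv s) y" using st G by (simp add: act_mult)
      moreover have "y \<in> ?X" using st G by simp
      ultimately show "(y, x) \<in> r" using st by (auto simp: r_def B_def)
    qed
    \<comment> \<open>\<open>r\<^sup>*\<close> is reflexive on the whole type and has to be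
      restricted to the space.\<close>
    define E where "E = r\<^sup>* \<inter> ?X \<times> ?X"
    have E: "equiv ?X E"
      using sym_rtrancl[OF \<open>sym r\<close>] trans_rtrancl[of r]
      unfolding equiv_def refl_on_def E_def sym_def trans_def by blast
    \<comment> \<open>A path in the graph is a word in \<open>B\<close> whose partial products keep
      the orbit in a single index set, which is what a return set records.\<close>
    have word: "\<exists>m b. (\<forall>k\<in>{1..m}. b k \<in> B) \<and> y = \<phi> (word_prod G b m) x \<and>
        (\<forall>k\<le>m. idx (\<phi> (word_prod G b k) x) = idx x)" if "(x, y) \<in> r\<^sup>*" and x: "x \<in> ?X" for x y
      using that(1)
    proof (induction rule: rtrancl_induct)
      case base
      show ?case by (rule exI[of _ 0]) (use x in simp)
    next
      case (step y z)
      obtain m b where b: "\<forall>k\<in>{1..m}. b k \<in> B" "y = \<phi> (word_prod G b m) x"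
        "\<forall>k\<le>m. idx (\<phi> (word_prod G b k) x) = idx x"
        using step.IH by (elim exE conjE)
      obtain c where c: "c \<in> B" "z = \<phi> c y" "idx y = idx z" using step(2) by (auto simp: r_def)
      let ?b = "b(Suc m := c)"
      have eq: "word_prod G ?b k = word_prod G b k" if "k \<le> m" for k
        by (rule word_prod_cong) (use that in auto)
      have "word_prod G b m \<in> carrier G" by (rule word_prod_closed) (use b B in auto)
      then have z: "z = \<phi> (word_prod G ?b (Suc m)) x"
        using eq[of m] b(2) c B x by (auto simp: act_mult subset_iff)
      have "idx (\<phi> (word_prod G ?b k) x) = idx x" if "k \<le> Suc m" for k
      proof (cases "k = Suc m")
        case True
        then show ?thesis using z c b by (metis order_refl)
      next
        case False
        then show ?thesis using that eq[of k] b(3) by simp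
      qed
      moreover have "\<forall>k\<in>{1..Suc m}. ?b k \<in> B" using b c by auto
      ultimately show ?case using z by blast
    qed
    \<comment> \<open>Return words have length at least 1, so the identity is added for the trivial
      path.\<close>
    define Q where "Q = insert \<one> (\<Union>i\<le>d. return_set G \<phi> B (U i)) \<inter> carrier G"
    have Q: "finite Q" "Q \<subseteq> carrier G" using U(3) by (auto simp: Q_def)
    have bdd: "\<exists>q\<in>Q. y = \<phi> q x" if xy: "(x, y) \<in> r\<^sup>*" and x: "x \<in> ?X" for x y
    proof -
      obtain m b where b: "\<forall>k\<in>{1..m}. b k \<in> B" "y = \<phi> (word_prod G b m) x"
        "\<forall>k\<le>m. idx (\<phi> (word_prod G b k) x) = idx x" using word[OF xy x] by (elim exE conjE)
      have wG: "word_prod G b k \<in> carrier G" if "k \<le> m" for k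
        by (rule word_prod_closed) (use b B that in auto)
      have inU: "\<phi> (word_prod G b k) x \<in> U (idx x)" if "k \<le> m" for k
        using idx(2)[of "\<phi> (word_prod G b k) x"] b(3) PU wG[OF that] x that by auto
      have "word_prod G b m \<in> Q"
      proof (cases "m = 0")
        case True
        then show ?thesis by (simp add: Q_def)
      next
        case False
        have "x \<in> U (idx x)" using idx(2)[OF x] PU by auto
        then have "word_prod G b m \<in> return_set G \<phi> B (U (idx x))"
          unfolding return_set_def using b inU False
          by (intro CollectI bexI[of _ x] exI[of _ m] exI[of _ b] conjI) auto
        then show ?thesis using idx(1)[OF x] wG[of m] by (auto simp: Q_def)
      qed
      then show ?thesis using b(2) by blast
    qed
    \<comment> \<open>Paths are unbounded in length, so connectedness is not visibly a finite
      Boolean condition. But every path from \<open>x\<close> stays in \<open>act Q {x}\<close>, so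
      it can be found in the finite graph \<open>L (V x)\<close> on group elements, and
      \<open>V\<close> is simple.\<close>
    define V where "V x = {q \<in> Q. idx (\<phi> q x) = idx x}" for x
    define L where "L v = {(t, b \<otimes> t) |t b. t \<in> v \<and> b \<in> B \<and> b \<otimes> t \<in> v}" for v
    have simple_V: "simple V" unfolding V_def
    proof (rule simple_Collect[OF Q(1)])
      fix q assume "q \<in> Q"
      then have "q \<in> carrier G" using Q by auto
      then show "meas (\<lambda>x. idx (\<phi> q x) = idx x)"
        by (intro meas_simple2[of _ _ "(=)"] simple_address[OF simple_idx] simple_idx address_act)
    qed
    have reach: "\<exists>t\<in>V x. y = \<phi> t x \<and> (\<one>, t) \<in> (L (V x))\<^sup>*" if "(x, y) \<in> r\<^sup>*" and x: "x \<in> ?X" for x y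
      using that(1)
    proof (induction rule: rtrancl_induct)
      case base
      have "\<one> \<in> V x" using x by (simp add: V_def Q_def)
      then show ?case using x by (intro bexI[of _ \<one>]) auto
    next
      case (step y z)
      then obtain t b where t: "t \<in> V x" "y = \<phi> t x" "(\<one>, t) \<in> (L (V x))\<^sup>*"
        and b: "b \<in> B" "z = \<phi> b y" "idx y = idx z" by (auto simp: r_def)
      have G: "t \<in> carrier G" "b \<in> carrier G" using t(1) b(1) Q(2) B by (auto simp: V_def)
      then have z: "z = \<phi> (b \<otimes> t) x" using t b x by (simp add: act_mult)
      obtain q where q: "q \<in> Q" "z = \<phi> q x"
        using bdd[OF rtrancl_into_rtrancl[OF step(1,2)] x] by auto
      then have "b \<otimes> t = q" using act_inj[of "b \<otimes> t" q x] G Q(2) x z by auto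
      then have "b \<otimes> t \<in> V x" using q b t z by (auto simp: V_def)
      moreover have "(t, b \<otimes> t) \<in> L (V x)" using t b calculation by (auto simp: L_def)
      ultimately show ?case using t(3) z by (intro bexI[of _ "b \<otimes> t"]) auto
    qed
    have reach': "g \<in> carrier G \<and> (x, \<phi> g x) \<in> r\<^sup>*" if "(\<one>, g) \<in> (L (V x))\<^sup>*" and x: "x \<in> ?X" for x g
      using that(1)
    proof (induction rule: rtrancl_induct)
      case base
      then show ?case using x by simp
    next
      case (step t u)
      then obtain b where b: "b \<in> B" "u = b \<otimes> t" "t \<in> V x" "u \<in> V x" by (auto simp: L_def)
      have G: "t \<in> carrier G" "b \<in> carrier G" using b B Q by (auto simp: V_def)
      have "\<phi> u x = \<phi> b (\<phi> t x)" using b G x by (simp add: act_mult)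
      then have "(\<phi> t x, \<phi> u x) \<in> r" using b G x by (auto simp: r_def V_def)
      then show ?case using step b G by (auto intro: rtrancl_into_rtrancl)
    qed
    have "meas (\<lambda>x. (x, \<phi> g x) \<in> E)" if g: "g \<in> carrier G" for g
    proof (rule meas_cong[OF meas_comp[OF simple_V, of "\<lambda>v. (\<one>, g) \<in> (L v)\<^sup>*"]])
      fix x assume x: "x \<in> ?X"
      show "(\<one>, g) \<in> (L (V x))\<^sup>* \<longleftrightarrow> (x, \<phi> g x) \<in> E"
      proof
        assume "(\<one>, g) \<in> (L (V x))\<^sup>*"
        then show "(x, \<phi> g x) \<in> E" using reach'[OF _ x] g x by (simp add: E_def)
      next
        assume "(x, \<phi> g x) \<in> E"
        then obtain t where t: "t \<in> V x" "\<phi> g x = \<phi> t x" "(\<one>, t) \<in> (L (V x))\<^sup>*"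
          using reach[OF _ x] by (auto simp: E_def)
        then have "g = t" using act_inj[OF g _ x, of t] Q(2) by (auto simp: V_def)
        then show "(\<one>, g) \<in> (L (V x))\<^sup>*" using t by simp
      qed
    qed
    moreover have "card ((\<lambda>y. E `` {y}) ` act S {x}) \<le> d + 1" if x: "x \<in> ?X" for x
    proof -
      have actX: "act S {x} \<subseteq> ?X" using S x by (simp add: act_subset)
      have "card ((\<lambda>y. E `` {y}) ` act S {x}) \<le> card (idx ` act S {x})"
      proof (rule card_image_le_of_factor)
        show "finite (act S {x})" using S by (simp add: finite_act)
        fix y z assume yz: "y \<in> act S {x}" "z \<in> act S {x}" "idx y = idx z"
        then obtain s t where st: "s \<in> S" "t \<in> S" "y = \<phi> s x" "z = \<phi> t x" by (auto simp: act_def)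
        have "(y, z) \<in> r" using yz actX BI[OF st(1,2) x] st(3,4) by (auto simp: r_def)
        then have "(y, z) \<in> E" using yz actX by (auto simp: E_def)
        then show "E `` {y} = E `` {z}" by (rule equiv_class_eq[OF E])
      qed
      also have "\<dots> \<le> card {..d}" by (rule card_mono) (use idx(1) actX in auto)
      finally show ?thesis by simp
    qed
    ultimately show "\<exists>E B. equiv ?X E \<and> finite B \<and> B \<subseteq> carrier G \<and>
        (\<forall>(x, y)\<in>E. \<exists>b\<in>B. y = \<phi> b x) \<and> (\<forall>g\<in>carrier G. meas (\<lambda>x. (x, \<phi> g x) \<in> E)) \<and>
        (\<forall>x\<in>?X. card ((\<lambda>y. E `` {y}) ` act S {x}) \<le> d + 1)"
      using E Q bdd by (intro exI[of _ E] exI[of _ Q]) (auto simp: E_def)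
  qed
qed

section \<open>Reduction to a finitely generated subgroup\<close>

lemma borel_action_measurable:
  assumes "borel_action G M \<phi>" "g \<in> carrier G"
  shows "\<phi> g \<in> M \<rightarrow>\<^sub>M M"
proof -
  have *: "(\<lambda>(g, x). \<phi> g x) \<in> count_space (carrier G) \<Otimes>\<^sub>M M \<rightarrow>\<^sub>M M"
    using assms(1) by (simp add: borel_action_def)
  have "Pair g \<in> M \<rightarrow>\<^sub>M count_space (carrier G) \<Otimes>\<^sub>M M"
    by (rule measurable_Pair1') (use assms(2) in simp)
  from measurable_compose[OF this *] show ?thesis by simp
qed

lemma continuous_action_map:
  assumes "continuous_action G T \<phi>" "g \<in> carrier G"
  shows "continuous_map T T (\<phi> g)"
proof -
  have "continuous_map T (prod_topology (discrete_topology (carrier G)) T) (\<lambda>x. (g, x))"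
    using assms(2) by (simp add: continuous_map_pairwise o_def)
  moreover have "continuous_map (prod_topology (discrete_topology (carrier G)) T) T (\<lambda>(g, x). \<phi> g x)"
    using assms(1) by (simp add: continuous_action_def)
  ultimately have "continuous_map T T ((\<lambda>(g, x). \<phi> g x) \<circ> (\<lambda>x. (g, x)))"
    by (rule continuous_map_compose)
  then show ?thesis by (simp add: o_def)
qed

text \<open>\<open>H\<close> and \<open>G\<close> share the multiplication, so tiles that are
  invariant in \<open>H\<close> are invariant in \<open>G\<close> with the same \<open>K\<close> and
  \<open>\<delta>\<close>.\<close>

lemma tiling_of_subgroup_action:
  fixes G :: "('g, 'm) monoid_scheme" and \<delta> :: real
  assumes am: "amenable_group G" and H: "subgroup H G"
    and act: "measured_action (G\<lparr>carrier := H\<rparr>) X \<phi> A"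
    and asd: "measured_action.asd_le (G\<lparr>carrier := H\<rparr>) X \<phi> A d"
    and K: "finite K" "K \<subseteq> H" "K \<noteq> {}" and \<delta>: "0 < \<delta>"
  shows "\<exists>(n::nat) F C. (\<forall>i\<in>{1..n}. invariant_set G K \<delta> (F i)) \<and> (\<forall>i\<in>{1..n}. C i \<in> A) \<and>
    bij_betw (\<lambda>(i, f, c). \<phi> f c) (SIGMA i:{1..n}. F i \<times> C i) X"
proof -
  let ?H = "G\<lparr>carrier := H\<rparr>"
  interpret measured_action ?H X \<phi> A by (rule act)
  have mult: "B <#>\<^bsub>?H\<^esub> C = B <#>\<^bsub>G\<^esub> C" for B C by (simp add: set_mult_def)
  have sub: "invariant_set G K \<delta> F" if "invariant_set ?H K \<delta> F" for F
    using that subgroup.subset[OF H] by (auto simp: invariant_set_def mult)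
  have K2: "K \<subseteq> carrier ?H" using K(2) by simp
  have am': "\<exists>W. finite W \<and> W \<noteq> {} \<and> W \<subseteq> carrier ?H \<and> card (Q <#>\<^bsub>?H\<^esub> W) \<le> 2 * card W"
    if "finite Q" "Q \<subseteq> carrier ?H" for Q
    using amenable_subgroup_doubling[OF am H, of Q] that by (simp add: mult)
  obtain n :: nat and F C where "\<And>i. i \<in> {1..n} \<Longrightarrow> invariant_set ?H K \<delta> (F i)"
    "\<And>i. i \<in> {1..n} \<Longrightarrow> C i \<in> A"
    "bij_betw (\<lambda>(i, f, c). \<phi> f c) (SIGMA i:{1..n}. F i \<times> C i) X"
    by (rule invariant_tiling[OF asd K(1) K2 K(3) \<delta> am']) (assumption+, rule that)
  then show ?thesis using sub by blast
qed

lemma free_action_subgroup: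
  "\<lbrakk>free_action G X \<phi>; subgroup H G\<rbrakk> \<Longrightarrow> free_action (G\<lparr>carrier := H\<rparr>) X \<phi>"
  using subgroup.subset by (fastforce simp: free_action_def)

theorem theorem1p4:
  fixes G :: "('g, 'm) monoid_scheme"
  assumes "group G" and "countable (carrier G)" and "amenable_group G"
  shows
    "(\<forall>(M :: 'x measure) \<phi>.
        standard_borel_space M \<and> borel_action G M \<phi> \<and> free_action G (space M) \<phi> \<and>
        (\<forall>H. fin_gen_subgroup H G \<longrightarrow> borel_asdim (G\<lparr>carrier := H\<rparr>) M \<phi> < \<infinity>) \<longrightarrow>
        (\<forall>K (\<delta>::real). finite K \<and> K \<noteq> {} \<and> K \<subseteq> carrier G \<and> \<delta> > 0 \<longrightarrow>
           (\<exists>(n::nat) F C.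
              (\<forall>i\<in>{1..n}. invariant_set G K \<delta> (F i)) \<and>
              (\<forall>i\<in>{1..n}. C i \<in> sets M) \<and>
              bij_betw (\<lambda>(i, f, c). \<phi> f c) (SIGMA i:{1..n}. F i \<times> C i) (space M)))) \<and>
     (\<forall>(T :: 'y topology) \<phi>.
        compact_space T \<and> zero_dimensional_space T \<and> second_countable T \<and> Hausdorff_space T \<and>
        continuous_action G T \<phi> \<and> free_action G (topspace T) \<phi> \<and>
        (\<forall>H. fin_gen_subgroup H G \<longrightarrow> dyn_asdim (G\<lparr>carrier := H\<rparr>) T \<phi> < \<infinity>) \<longrightarrow>
        (\<forall>K (\<delta>::real). finite K \<and> K \<noteq> {} \<and> K \<subseteq> carrier G \<and> \<delta> > 0 \<longrightarrow>
           (\<exists>(n::nat) F C.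
              (\<forall>i\<in>{1..n}. invariant_set G K \<delta> (F i)) \<and>
              (\<forall>i\<in>{1..n}. openin T (C i) \<and> closedin T (C i)) \<and>
              bij_betw (\<lambda>(i, f, c). \<phi> f c) (SIGMA i:{1..n}. F i \<times> C i) (topspace T))))"
proof (intro conjI allI impI; elim conjE)
  interpret group G by fact
  fix M :: "'x measure" and \<phi> K and \<delta> :: real
  assume std: "standard_borel_space M" and act: "borel_action G M \<phi>" and free: "free_action G (space M) \<phi>"
    and asd: "\<forall>H. fin_gen_subgroup H G \<longrightarrow> borel_asdim (G\<lparr>carrier := H\<rparr>) M \<phi> < \<infinity>"
    and K: "finite K" "K \<noteq> {}" "K \<subseteq> carrier G" and \<delta>: "0 < \<delta>"
  let ?H = "generate G K"
  have H: "subgroup ?H G" using K(3) by (rule generate_is_subgroup)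
  have "fin_gen_subgroup ?H G" using H K by (auto simp: fin_gen_subgroup_def)
  then obtain \<tau> d where \<tau>: "proper_right_invariant_metric (G\<lparr>carrier := ?H\<rparr>) \<tau>"
    "borel_asdim_le (G\<lparr>carrier := ?H\<rparr>) M \<phi> \<tau> d"
    using asd borel_asdim_finiteD by blast
  have meas: "\<phi> g \<in> M \<rightarrow>\<^sub>M M" if "g \<in> carrier (G\<lparr>carrier := ?H\<rparr>)" for g
    using borel_action_measurable[OF act] subgroup.subset[OF H] that by auto
  have ms: "measured_action (G\<lparr>carrier := ?H\<rparr>) (space M) \<phi> (sets M)"
    using act by (intro borel_measured_action group_action.induced_action H free_action_subgroup free meas std)
      (simp_all add: borel_action_def)
  have "K \<subseteq> ?H" by (auto intro: generate.incl)
  from tiling_of_subgroup_action[OF assms(3) H ms borel_asd_le[OF ms meas \<tau>] K(1) this K(2) \<delta>]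
  show "\<exists>(n::nat) F C. (\<forall>i\<in>{1..n}. invariant_set G K \<delta> (F i)) \<and> (\<forall>i\<in>{1..n}. C i \<in> sets M) \<and>
      bij_betw (\<lambda>(i, f, c). \<phi> f c) (SIGMA i:{1..n}. F i \<times> C i) (space M)" by blast
next
  interpret group G by fact
  fix T :: "'y topology" and \<phi> K and \<delta> :: real
  assume T: "compact_space T" "zero_dimensional_space T" "Hausdorff_space T"
    and act: "continuous_action G T \<phi>" and free: "free_action G (topspace T) \<phi>"
    and asd: "\<forall>H. fin_gen_subgroup H G \<longrightarrow> dyn_asdim (G\<lparr>carrier := H\<rparr>) T \<phi> < \<infinity>"
    and K: "finite K" "K \<noteq> {}" "K \<subseteq> carrier G" and \<delta>: "0 < \<delta>"
  let ?H = "generate G K"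
  have H: "subgroup ?H G" using K(3) by (rule generate_is_subgroup)
  have "fin_gen_subgroup ?H G" using H K by (auto simp: fin_gen_subgroup_def)
  then have "dyn_asdim (G\<lparr>carrier := ?H\<rparr>) T \<phi> < \<infinity>" using asd by blast
  then obtain d where d: "dyn_asdim_le (G\<lparr>carrier := ?H\<rparr>) T \<phi> d"
    unfolding dyn_asdim_def INF_less_iff by blast
  have cont: "continuous_map T T (\<phi> g)" if "g \<in> carrier (G\<lparr>carrier := ?H\<rparr>)" for g
    using continuous_action_map[OF act] subgroup.subset[OF H] that by auto
  have ms: "measured_action (G\<lparr>carrier := ?H\<rparr>) (topspace T) \<phi> {U. openin T U \<and> closedin T U}"
    using act by (intro clopen_measured_action group_action.induced_action H free_action_subgroup free cont T)
      (simp_all add: continuous_action_def)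
  have "K \<subseteq> ?H" by (auto intro: generate.incl)
  from tiling_of_subgroup_action[OF assms(3) H ms clopen_asd_le[OF ms T(1,2) d] K(1) this K(2) \<delta>]
  show "\<exists>(n::nat) F C. (\<forall>i\<in>{1..n}. invariant_set G K \<delta> (F i)) \<and>
      (\<forall>i\<in>{1..n}. openin T (C i) \<and> closedin T (C i)) \<and>
      bij_betw (\<lambda>(i, f, c). \<phi> f c) (SIGMA i:{1..n}. F i \<times> C i) (topspace T)" by simp
qed

end
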